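(* There exists $\beta_0>0$ such that for all $h\in\mathbb{R}$ and all $\beta$ with $0<\beta\le\beta_0$, $$f(\beta,h)=\operatorname{RS}(\beta,h):=\inf_{q\ge 0}\left[\int_{\mathbb{R}}\log\cosh\left(h+\beta\sqrt{q}\,x\right)\phi(dx)+\frac{\beta^2(1-q)^2}{4}\right],$$ where $\phi(dx)=(2\pi)^{-1/2}e^{-x^2/2}dx$ is the standard Gaussian distribution and $f(\beta,h)$ is the limiting free energy of the Sherrington-Kirkpatrick model with external field.
   Context: Let $\beta>0$ and $h\in\mathbb{R}$. For each $N\ge1$ let $g_{ij}=g_{ij}^{(N)}$, $1\le i,j\le N$, be i.i.d. centered Gaussian random variables with variance $1/N$ on a probability space $(\Omega,\mathcal{F},\mathbb{P})$ (all $N^2$ entries are independent). For $\sigma=(\sigma_i)\in\{-1,1\}^N$ put $$H_{\beta,h}(\sigma)=\frac{\beta}{\sqrt2}\sum_{i,j=1}^N g_{ij}\sigma_i\sigma_j+h\sum_{i=1}^N\sigma_i,\qquad Z_N=Z_{N,\beta,h}=2^{-N}\sum_{\sigma\in\{-1,1\}^N}\exp[H_{\beta,h}(\sigma)].$$ The limiting free energy is $$f(\beta,h)=\lim_{N\to\infty}\frac1N\log Z_{N,\beta,h}=\lim_{N\to\infty}\frac1N\mathbb{E}\log Z_{N,\beta,h};$$ it is known that these limits exist (the first one almost surely), agree, and are non-random. *)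

theory Defs
  imports "HOL-Probability.Probability"
begin

(* For every N, the N * N couplings g N i j (1 <= i, j <= N, no symmetry imposed) are i.i.d.
   centered Gaussians with variance 1/N.  The second parameter of normal_density is the
   standard deviation.  Nothing is assumed about the joint law for different N, nor about
   indices outside the stated range. *)
locale sk_disorder = prob_space M for M :: "'a measure" +
  fixes g :: "nat \<Rightarrow> nat \<Rightarrow> nat \<Rightarrow> 'a \<Rightarrow> real"
  assumes indep: "N \<ge> 1 \<Longrightarrow>
      indep_vars (\<lambda>_. borel) (\<lambda>(i, j). g N i j) ({1..N} \<times> {1..N})"
    and gaussian: "N \<ge> 1 \<Longrightarrow> i \<in> {1..N} \<Longrightarrow> j \<in> {1..N} \<Longrightarrow>
      distributed M lborel (g N i j) (normal_density 0 (sqrt (1 / real N)))"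

definition sk_configs :: "nat \<Rightarrow> (nat \<Rightarrow> real) set" where
  "sk_configs N = {1..N} \<rightarrow>\<^sub>E {-1, 1}"

definition sk_energy ::
    "real \<Rightarrow> real \<Rightarrow> nat \<Rightarrow> (nat \<Rightarrow> nat \<Rightarrow> real) \<Rightarrow> (nat \<Rightarrow> real) \<Rightarrow> real" where
  "sk_energy \<beta> h N G \<sigma> =
     \<beta> / sqrt 2 * (\<Sum>i=1..N. \<Sum>j=1..N. G i j * \<sigma> i * \<sigma> j) + h * (\<Sum>i=1..N. \<sigma> i)"

definition sk_partition :: "real \<Rightarrow> real \<Rightarrow> nat \<Rightarrow> (nat \<Rightarrow> nat \<Rightarrow> real) \<Rightarrow> real" where
  "sk_partition \<beta> h N G = (\<Sum>\<sigma>\<in>sk_configs N. exp (sk_energy \<beta> h N G \<sigma>)) / 2 ^ N"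

definition sk_log_density ::
    "(nat \<Rightarrow> nat \<Rightarrow> nat \<Rightarrow> 'a \<Rightarrow> real) \<Rightarrow> real \<Rightarrow> real \<Rightarrow> nat \<Rightarrow> 'a \<Rightarrow> real" where
  "sk_log_density g \<beta> h N \<omega> = ln (sk_partition \<beta> h N (\<lambda>i j. g N i j \<omega>)) / real N"

(* lim is only meaningful for convergent sequences, so a statement about this constant
   should be accompanied by the convergence. *)
definition sk_free_energy ::
    "'a measure \<Rightarrow> (nat \<Rightarrow> nat \<Rightarrow> nat \<Rightarrow> 'a \<Rightarrow> real) \<Rightarrow> real \<Rightarrow> real \<Rightarrow> real" where
  "sk_free_energy M g \<beta> h = lim (\<lambda>N. \<integral>\<omega>. sk_log_density g \<beta> h N \<omega> \<partial>M)"

(* The functional is integrable and nonnegative for every q >= 0, so the infimum is a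
   genuine one. *)
definition RS :: "real \<Rightarrow> real \<Rightarrow> real" where
  "RS \<beta> h =
     (INF q\<in>{0..}. (\<integral>x. ln (cosh (h + \<beta> * sqrt q * x)) \<partial>std_normal_distribution)
        + \<beta>\<^sup>2 * (1 - q)\<^sup>2 / 4)"

end

theory Submission
  imports Defs "HOL-Real_Asymp.Real_Asymp"
begin

text \<open>
  The argument is the quadratic replica coupling of Guerra and Toninelli. Interpolate, along
  \<open>sin t\<close> and \<open>cos t\<close>, between the Sherrington-Kirkpatrick Hamiltonian and independent spins in random
  fields of variance \<open>\<beta>\<^sup>2 q\<close>. By Gaussian integration by parts the derivative of the free energy equals
  that of the replica symmetric value minus the expected squared fluctuation of the overlap of two
  replicas around \<open>q\<close>. Hence every \<open>q \<ge> 0\<close> gives an upper bound.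

  For the lower bound choose \<open>q\<close> with \<open>q = E tanh\<^sup>2 (h + \<beta> \<surd>q x)\<close> and add to two replicas the coupling
  \<open>\<lambda> N (R - q)\<^sup>2\<close>, with \<open>\<lambda>\<close> decreasing in \<open>t\<close> so that the coupled free energy grows no faster
  than twice the replica symmetric value. By convexity in \<open>\<lambda>\<close> it bounds the overlap fluctuation by
  the deficit of the free energy, up to the value at \<open>t = 0\<close>; there the spins are
  independent and the coupling costs only a constant when \<open>\<lambda> < 1 / 2\<close>. Gronwall's inequality then
  makes the deficit bounded in \<open>N\<close>. Almost sure convergence follows from Gaussian concentration and the
  Borel-Cantelli lemma.
\<close>

section \<open>Gaussian integration by parts\<close>

text \<open>The derivative of the free energy carries the overlap fluctuation with a negative sign,
  so one inequality is immediate and the difficulty lies in the other. On the trigonometric path all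
  coefficients have derivatives bounded uniformly in t, so one dominating function serves
  throughout; square roots of t would be singular at the ends. The condition q = E tanh^2 says that
  for independent spins the overlap of two replicas has mean q, hence the coupling costs O(1) and
  not O(N) at the start. Constants: the coupling begins at 1 / 4, where its cost is at most ln (sqrt
  2), and loses at most beta^2 / 2 along the path; for beta <= 1 / 2 at least 1 / 8 is left, which
  matches the bound beta^2 / 2 <= 1 / 8 on the rate in the derivative of the deficit. This is the
  origin of the threshold 1 / 2, and nothing in it depends on h. No minimiser of the functional in
  \<open>RS\<close> has to be identified: the upper bound holds for all q, the lower bound at the
  fixed point, and together they squeeze the limit. Existence of the limits is thus a conclusion,
  not an input.\<close>

abbreviation gauss :: "real measure" where "gauss \<equiv> std_normal_distribution"

lemma prob_space_gauss: "prob_space gauss"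
  by (rule prob_space_normal_density) simp

interpretation gauss: prob_space gauss
  by (rule prob_space_gauss)

interpretation gauss_prod: product_prob_space "\<lambda>_. gauss" I for I
  by unfold_locales

lemma gauss_prob_UNIV [simp]: "measure gauss UNIV = 1"
  using gauss.prob_space by simp

lemma gauss_integral:
  fixes f :: "real \<Rightarrow> real"
  assumes "f \<in> borel_measurable borel"
  shows "(\<integral>x. f x \<partial>gauss) = (\<integral>x. std_normal_density x * f x \<partial>lborel)"
  using assms by (subst integral_density) auto

lemma gauss_integrable_iff:
  fixes f :: "real \<Rightarrow> real"
  assumes "f \<in> borel_measurable borel"
  shows "integrable gauss f \<longleftrightarrow> integrable lborel (\<lambda>x. std_normal_density x * f x)"
  using assms by (subst integrable_density) auto

text \<open>Completing the square turns the tilted density into a multiple of the one with mean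
  t.\<close>

lemma gauss_exp:
  "integrable gauss (\<lambda>x. exp (t * x))" "(\<integral>x. exp (t * x) \<partial>gauss) = exp (t\<^sup>2 / 2)"
proof -
  have eq: "std_normal_density x * exp (t * x) = exp (t\<^sup>2 / 2) * normal_density t 1 x" for x
  proof -
    have "- x\<^sup>2 / 2 + t * x = t\<^sup>2 / 2 + - (x - t)\<^sup>2 / 2"
      by (simp add: power2_eq_square field_simps)
    then have "exp (- x\<^sup>2 / 2) * exp (t * x) = exp (t\<^sup>2 / 2) * exp (- (x - t)\<^sup>2 / 2)"
      by (metis exp_add)
    then show ?thesis by (simp add: normal_density_def)
  qed
  show "integrable gauss (\<lambda>x. exp (t * x))"
    by (subst gauss_integrable_iff) (auto simp: eq integrable_normal_density)
  show "(\<integral>x. exp (t * x) \<partial>gauss) = exp (t\<^sup>2 / 2)"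
    by (subst gauss_integral) (auto simp: eq integral_normal_density)
qed

lemma gauss_integrable_abs: "integrable gauss (\<lambda>x. \<bar>x\<bar>)"
  using integrable_std_normal_moment_abs[of 1] by (subst gauss_integrable_iff) auto

lemma std_normal_density_deriv:
  "(std_normal_density has_real_derivative - x * std_normal_density x) (at x)"
proof -
  have "((\<lambda>x. c * exp (- x\<^sup>2 / 2)) has_real_derivative - x * (c * exp (- x\<^sup>2 / 2))) (at x)" for c
    by (auto intro!: derivative_eq_intros)
  then show ?thesis
    unfolding std_normal_density_def [abs_def] .
qed

text \<open>The fundamental theorem of calculus for f times the density phi, whose derivative is f'
  phi - x f phi. Boundedness of f and f' gives integrability and kills the boundary terms.\<close>

lemma gauss_ibp:
  fixes f f' :: "real \<Rightarrow> real"
  assumes deriv: "\<And>x. (f has_real_derivative f' x) (at x)"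
    and cont: "continuous_on UNIV f'"
    and bound: "\<And>x. \<bar>f x\<bar> \<le> C" and bound': "\<And>x. \<bar>f' x\<bar> \<le> C'"
  shows "(\<integral>x. x * f x \<partial>gauss) = (\<integral>x. f' x \<partial>gauss)"
proof -
  have contf: "continuous_on UNIV f"
    using deriv by (meson DERIV_isCont continuous_at_imp_continuous_on)
  have [measurable]: "f \<in> borel_measurable borel" "f' \<in> borel_measurable borel"
    using contf cont by (auto intro: borel_measurable_continuous_onI)
  define g where "g = (\<lambda>x. f' x * std_normal_density x - x * f x * std_normal_density x)"
  have int1: "integrable lborel (\<lambda>x. f' x * std_normal_density x)"
  proof (rule Bochner_Integration.integrable_bound)
    show "integrable lborel (\<lambda>x. C' * std_normal_density x)" by auto
    have "\<bar>f' x\<bar> * std_normal_density x \<le> \<bar>C'\<bar> * std_normal_density x" for x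
      using bound'[of x] by (intro mult_right_mono) auto
    then show "AE x in lborel. norm (f' x * std_normal_density x) \<le> norm (C' * std_normal_density x)"
      by (simp add: abs_mult)
  qed simp
  have int2: "integrable lborel (\<lambda>x. x * f x * std_normal_density x)"
  proof (rule Bochner_Integration.integrable_bound)
    show "integrable lborel (\<lambda>x. C * (std_normal_density x * \<bar>x\<bar>))"
      using integrable_std_normal_moment_abs[of 1] by auto
    have "\<bar>x\<bar> * \<bar>f x\<bar> * std_normal_density x \<le> \<bar>x\<bar> * \<bar>C\<bar> * std_normal_density x" for x
      using bound[of x] by (intro mult_right_mono mult_left_mono) auto
    then show "AE x in lborel. norm (x * f x * std_normal_density x)
        \<le> norm (C * (std_normal_density x * \<bar>x\<bar>))"
      by (simp add: abs_mult mult_ac)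
  qed simp
  \<comment> \<open>Stated for an arbitrary filter so that both ends of the line are covered at
    once.\<close>
  have lim: "((\<lambda>x. f x * std_normal_density x) \<longlongrightarrow> 0) F" if "filterlim (\<lambda>x. x\<^sup>2 / 2 :: real) at_top F" for F
  proof (rule tendsto_rabs_zero_cancel, rule tendsto_sandwich)
    show "\<forall>\<^sub>F x in F. 0 \<le> \<bar>f x * std_normal_density x\<bar>" by simp
    have "\<bar>f x\<bar> * std_normal_density x \<le> C * std_normal_density x" for x
      using bound by (intro mult_right_mono) auto
    then show "\<forall>\<^sub>F x in F. \<bar>f x * std_normal_density x\<bar> \<le> C * (1 / sqrt (2 * pi) * exp (- (x\<^sup>2 / 2)))"
      by (intro always_eventually allI) (simp add: abs_mult std_normal_density_def)
    have "((\<lambda>x. exp (- (x\<^sup>2 / 2 :: real))) \<longlongrightarrow> 0) F"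
      by (rule filterlim_compose[OF exp_at_bot])
         (use that in \<open>simp add: filterlim_uminus_at_bot\<close>)
    then show "((\<lambda>x. C * (1 / sqrt (2 * pi) * exp (- (x\<^sup>2 / 2)))) \<longlongrightarrow> 0) F"
      by (intro tendsto_mult_right_zero)
  qed auto
  have top: "filterlim (\<lambda>x. x\<^sup>2 / 2 :: real) at_top at_top" by real_asymp
  have bot: "filterlim (\<lambda>x. x\<^sup>2 / 2 :: real) at_top at_bot" by real_asymp
  have "(LBINT x=-\<infinity>..\<infinity>. g x) = 0 - 0"
  proof (rule interval_integral_FTC_integrable[where F = "\<lambda>x. f x * std_normal_density x"])
    fix x :: real
    show "((\<lambda>x. f x * std_normal_density x) has_vector_derivative g x) (at x)"
      unfolding has_real_derivative_iff_has_vector_derivative[symmetric] g_def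
      by (rule DERIV_cong[OF DERIV_mult[OF deriv std_normal_density_deriv]]) (simp add: algebra_simps)
    show "isCont g x"
      unfolding g_def std_normal_density_def
      using cont contf by (auto intro!: continuous_intros simp: continuous_on_eq_continuous_at)
  next
    show "set_integrable lborel (einterval (-\<infinity>) \<infinity>) g"
      unfolding set_integrable_def g_def using int1 int2 by simp
    show "(((\<lambda>x. f x * std_normal_density x) \<circ> real_of_ereal) \<longlongrightarrow> 0) (at_right (- \<infinity>))"
      by (simp add: ereal_tendsto_simps lim[OF bot])
    show "(((\<lambda>x. f x * std_normal_density x) \<circ> real_of_ereal) \<longlongrightarrow> 0) (at_left \<infinity>)"
      by (simp add: ereal_tendsto_simps lim[OF top])
  qed simp
  then have "(\<integral>x. g x \<partial>lborel) = 0"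
    by (simp add: interval_lebesgue_integral_def set_lebesgue_integral_def)
  then have "(\<integral>x. x * f x * std_normal_density x \<partial>lborel) = (\<integral>x. f' x * std_normal_density x \<partial>lborel)"
    unfolding g_def using int1 int2 by simp
  then show ?thesis
    by (simp add: gauss_integral mult_ac)
qed

section \<open>Products of standard Gaussians\<close>

abbreviation gaussP :: "'i set \<Rightarrow> ('i \<Rightarrow> real) measure" where
  "gaussP K \<equiv> Pi\<^sub>M K (\<lambda>_. gauss)"

lemma gaussP_coord:
  fixes f :: "real \<Rightarrow> real"
  assumes "k \<in> K" "f \<in> borel_measurable borel"
  shows "(\<integral>x. f (x k) \<partial>gaussP K) = (\<integral>y. f y \<partial>gauss)"
    "integrable (gaussP K) (\<lambda>x. f (x k)) \<longleftrightarrow> integrable gauss f"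
proof -
  have d: "distr (gaussP K) gauss (\<lambda>x. x k) = gauss"
    using gauss_prod.PiM_component[OF assms(1)] .
  have m: "(\<lambda>x. x k) \<in> measurable (gaussP K) gauss" 
    using assms(1) by (intro measurable_component_singleton)
  show "(\<integral>x. f (x k) \<partial>gaussP K) = (\<integral>y. f y \<partial>gauss)"
    using integral_distr[OF m, of f] assms(2) d by simp
  show "integrable (gaussP K) (\<lambda>x. f (x k)) \<longleftrightarrow> integrable gauss f"
    using integrable_distr_eq[OF m, of f] assms(2) d by simp
qed

lemma gaussP_integrable_abs: "k \<in> K \<Longrightarrow> integrable (gaussP K) (\<lambda>x. \<bar>x k\<bar>)"
  using gaussP_coord(2)[of k K abs] gauss_integrable_abs by simp

lemma gaussP_measurable_coord: "k \<in> K \<Longrightarrow> (\<lambda>x. x k) \<in> borel_measurable (gaussP K)"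
  using measurable_component_singleton[of k K "\<lambda>_. gauss"] by simp

lemma integrable_times_coord:
  assumes "finite K" "k \<in> K" "f \<in> borel_measurable (gaussP K)" "\<And>x. \<bar>f x\<bar> \<le> (C :: real)"
  shows "integrable (gaussP K) (\<lambda>x. x k * f x)"
proof (rule Bochner_Integration.integrable_bound)
  show "integrable (gaussP K) (\<lambda>x. C * \<bar>x k\<bar>)" using gaussP_integrable_abs[OF assms(2)] by simp
  show "AE x in gaussP K. norm (x k * f x) \<le> norm (C * \<bar>x k\<bar>)"
  proof (rule AE_I2)
    fix x
    have "\<bar>x k\<bar> * \<bar>f x\<bar> \<le> \<bar>x k\<bar> * \<bar>C\<bar>" using assms(4)[of x] by (intro mult_left_mono) auto
    then show "norm (x k * f x) \<le> norm (C * \<bar>x k\<bar>)" by (simp add: abs_mult mult_ac)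
  qed
qed (intro borel_measurable_times gaussP_measurable_coord assms)

text \<open>Fubini isolates the coordinate k, and the one-dimensional formula is applied with the
  others frozen.\<close>

lemma gaussP_ibp:
  fixes f f' :: "('i \<Rightarrow> real) \<Rightarrow> real"
  assumes K: "finite K" "k \<in> K"
    and meas: "f \<in> borel_measurable (gaussP K)" "f' \<in> borel_measurable (gaussP K)"
    and deriv: "\<And>x y. ((\<lambda>y. f (x(k := y))) has_real_derivative f' (x(k := y))) (at y)"
    and cont: "\<And>x. continuous_on UNIV (\<lambda>y. f' (x(k := y)))"
    and bound: "\<And>x. \<bar>f x\<bar> \<le> C" and bound': "\<And>x. \<bar>f' x\<bar> \<le> C'"
  shows "(\<integral>x. x k * f x \<partial>gaussP K) = (\<integral>x. f' x \<partial>gaussP K)"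
proof -
  define I where "I = K - {k}"
  have I: "finite I" "k \<notin> I" "K = insert k I" using K by (auto simp: I_def)
  have "integrable (gaussP K) (\<lambda>x. x k * f x)"
    by (rule integrable_times_coord[OF K meas(1) bound])
  then have "(\<integral>x. x k * f x \<partial>gaussP K) = (\<integral>x. (\<integral>y. y * f (x(k := y)) \<partial>gauss) \<partial>gaussP I)"
    unfolding I(3) by (subst gauss_prod.product_integral_insert) (use I in auto)
  also have "\<dots> = (\<integral>x. (\<integral>y. f' (x(k := y)) \<partial>gauss) \<partial>gaussP I)"
    by (intro Bochner_Integration.integral_cong refl gauss_ibp[where C = C and C' = C'] deriv cont bound bound')
  also have "integrable (gaussP K) f'"
    by (rule gauss_prod.P.integrable_const_bound[where B = C']) (simp_all add: bound' meas)
  then have "(\<integral>x. (\<integral>y. f' (x(k := y)) \<partial>gauss) \<partial>gaussP I) = (\<integral>x. f' x \<partial>gaussP K)"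
    unfolding I(3) by (subst gauss_prod.product_integral_insert) (use I in auto)
  finally show ?thesis .
qed

text \<open>The mean value inequality bounds every difference quotient by w, so dominated
  convergence applies along any sequence tending to t. This is why the bound by w is uniform in
  t.\<close>

lemma has_real_derivative_integral:
  fixes f f' :: "real \<Rightarrow> 'a \<Rightarrow> real"
  assumes int: "\<And>t. integrable M (f t)"
    and deriv: "\<And>t x. x \<in> space M \<Longrightarrow> ((\<lambda>t. f t x) has_real_derivative f' t x) (at t)"
    and w: "integrable M w" and bound: "\<And>t x. x \<in> space M \<Longrightarrow> \<bar>f' t x\<bar> \<le> w x"
    and meas: "f' t \<in> borel_measurable M"
  shows "((\<lambda>t. \<integral>x. f t x \<partial>M) has_real_derivative (\<integral>x. f' t x \<partial>M)) (at t)"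
  unfolding has_field_derivative_iff
proof (subst tendsto_at_iff_sequentially, safe)
  fix X :: "nat \<Rightarrow> real" assume X: "X \<longlonglongrightarrow> t" "\<forall>i. X i \<in> UNIV - {t}"
  have Xt: "X i \<noteq> t" for i using X(2) by auto
  have "(\<lambda>i. \<integral>x. (f (X i) x - f t x) / (X i - t) \<partial>M) \<longlonglongrightarrow> (\<integral>x. f' t x \<partial>M)"
  proof (rule integral_dominated_convergence[where w = w])
    show "AE x in M. (\<lambda>i. (f (X i) x - f t x) / (X i - t)) \<longlonglongrightarrow> f' t x"
    proof (rule AE_I2)
      fix x assume "x \<in> space M"
      from deriv[OF this, of t]
      have "((\<lambda>s. (f s x - f t x) / (s - t)) \<longlongrightarrow> f' t x) (at t)"
        by (simp add: has_field_derivative_iff)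
      then show "(\<lambda>i. (f (X i) x - f t x) / (X i - t)) \<longlonglongrightarrow> f' t x"
        using X Xt by (auto simp: tendsto_at_iff_sequentially o_def)
    qed
    show "AE x in M. norm ((f (X i) x - f t x) / (X i - t)) \<le> w x" for i
    proof (rule AE_I2)
      fix x assume x: "x \<in> space M"
      have "\<bar>f (X i) x - f t x\<bar> \<le> w x * \<bar>X i - t\<bar>"
        using field_differentiable_bound[of UNIV "\<lambda>t. f t x" "\<lambda>t. f' t x" "w x" "X i" t]
          deriv[OF x] bound[OF x] by simp
      then show "norm ((f (X i) x - f t x) / (X i - t)) \<le> w x"
        using Xt[of i] by (simp add: divide_simps)
    qed
  qed (use int w meas in \<open>auto intro!: borel_measurable_divide borel_measurable_diff simp: integrable_iff_bounded\<close>)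
  moreover have "(\<integral>x. (f (X i) x - f t x) / (X i - t) \<partial>M)
      = ((\<integral>x. f (X i) x \<partial>M) - (\<integral>x. f t x \<partial>M)) / (X i - t)" for i
    using int by simp
  ultimately show "((\<lambda>y. ((\<integral>x. f y x \<partial>M) - (\<integral>x. f t x \<partial>M)) / (y - t)) \<circ> X) \<longlonglongrightarrow> (\<integral>x. f' t x \<partial>M)"
    by (simp only: o_def)
qed

section \<open>Gibbs averages and Gaussian interpolation\<close>

definition pf :: "'s set \<Rightarrow> ('s \<Rightarrow> real) \<Rightarrow> real" where
  "pf S H = (\<Sum>s\<in>S. exp (H s))"

definition gibbs :: "'s set \<Rightarrow> ('s \<Rightarrow> real) \<Rightarrow> ('s \<Rightarrow> real) \<Rightarrow> real" where
  "gibbs S H f = (\<Sum>s\<in>S. exp (H s) * f s) / pf S H"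

lemma pf_pos: "finite S \<Longrightarrow> S \<noteq> {} \<Longrightarrow> pf S H > 0"
  unfolding pf_def by (intro sum_pos) auto

lemma gibbs_add: "gibbs S H (\<lambda>s. f s + g s) = gibbs S H f + gibbs S H g"
  by (simp add: gibbs_def sum.distrib distrib_left add_divide_distrib)

lemma gibbs_diff: "gibbs S H (\<lambda>s. f s - g s) = gibbs S H f - gibbs S H g"
  by (simp add: gibbs_def sum_subtractf right_diff_distrib diff_divide_distrib)

lemma gibbs_cmult: "gibbs S H (\<lambda>s. c * f s) = c * gibbs S H f"
  by (simp add: gibbs_def sum_distrib_left mult_ac)

lemma gibbs_sum: "gibbs S H (\<lambda>s. \<Sum>k\<in>K. f k s) = (\<Sum>k\<in>K. gibbs S H (f k))"
  by (simp add: gibbs_def sum_distrib_left sum_divide_distrib) (rule sum.swap)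

lemma gibbs_const: "finite S \<Longrightarrow> S \<noteq> {} \<Longrightarrow> gibbs S H (\<lambda>s. c) = c"
  using pf_pos[of S H] by (simp add: gibbs_def pf_def sum_distrib_right[symmetric])

lemma gibbs_mono:
  assumes "finite S" "S \<noteq> {}" "\<And>s. s \<in> S \<Longrightarrow> f s \<le> g s"
  shows "gibbs S H f \<le> gibbs S H g"
  unfolding gibbs_def using pf_pos[OF assms(1,2), of H] assms(3)
  by (intro divide_right_mono sum_mono mult_left_mono) auto

lemma gibbs_nonneg: "(\<And>s. s \<in> S \<Longrightarrow> 0 \<le> f s) \<Longrightarrow> 0 \<le> gibbs S H f"
  unfolding gibbs_def pf_def by (intro divide_nonneg_nonneg sum_nonneg) auto

lemma gibbs_cong: "(\<And>s. s \<in> S \<Longrightarrow> f s = g s) \<Longrightarrow> gibbs S H f = gibbs S H g"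
  by (simp add: gibbs_def)

lemma abs_gibbs_le:
  assumes "finite S" "S \<noteq> {}" "\<And>s. s \<in> S \<Longrightarrow> \<bar>f s\<bar> \<le> C"
  shows "\<bar>gibbs S H f\<bar> \<le> C"
proof -
  have "gibbs S H f \<le> gibbs S H (\<lambda>s. C)" "gibbs S H (\<lambda>s. -C) \<le> gibbs S H f"
    using assms by (auto intro!: gibbs_mono simp: abs_le_iff minus_le_iff)
  then show ?thesis using gibbs_const[OF assms(1,2)] by simp
qed

text \<open>Jensen's inequality, from the tangent of exp at the mean \<open>m\<close>.\<close>

lemma exp_gibbs_le:
  assumes "finite S" "S \<noteq> {}"
  shows "exp (gibbs S H f) \<le> gibbs S H (\<lambda>s. exp (f s))"
proof -
  define m where "m = gibbs S H f"
  have "gibbs S H (\<lambda>s. exp m * (1 - m) + exp m * f s) \<le> gibbs S H (\<lambda>s. exp (f s))"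
  proof (rule gibbs_mono[OF assms])
    fix s
    have "1 + (f s - m) \<le> exp (f s - m)" by (rule exp_ge_add_one_self)
    then have "exp m * (1 + (f s - m)) \<le> exp m * exp (f s - m)" by (intro mult_left_mono) auto
    then show "exp m * (1 - m) + exp m * f s \<le> exp (f s)"
      by (simp add: exp_diff algebra_simps)
  qed
  then show ?thesis
    unfolding gibbs_add gibbs_cmult gibbs_const[OF assms] m_def [symmetric]
    by (simp add: algebra_simps)
qed

lemma pf_add: "finite S \<Longrightarrow> S \<noteq> {} \<Longrightarrow> pf S (\<lambda>s. H s + f s) = pf S H * gibbs S H (\<lambda>s. exp (f s))"
  using pf_pos[of S H] by (simp add: pf_def gibbs_def exp_add)

lemma pf_pair: "pf (S \<times> S) (\<lambda>(s, t). H s + H t) = (pf S H)\<^sup>2"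
proof -
  have "pf (S \<times> S) (\<lambda>(s, t). H s + H t) = (\<Sum>s\<in>S. \<Sum>t\<in>S. exp (H s) * exp (H t))"
    unfolding pf_def sum.cartesian_product by (intro sum.cong) (auto simp: exp_add)
  then show ?thesis
    unfolding pf_def power2_eq_square sum_product .
qed

text \<open>Two replicas in the same disorder are independent under the product Gibbs measure;
  iterated averages can thus be treated as a single average over pairs.\<close>

lemma gibbs_pair:
  "gibbs (S \<times> S) (\<lambda>(s, t). H s + H t) (\<lambda>(s, t). f s t) = gibbs S H (\<lambda>s. gibbs S H (f s))"
proof -
  have "(\<Sum>p\<in>S \<times> S. exp (case p of (s, t) \<Rightarrow> H s + H t) * (case p of (s, t) \<Rightarrow> f s t)) =
      (\<Sum>s\<in>S. \<Sum>t\<in>S. exp (H s) * (exp (H t) * f s t))"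
    unfolding sum.cartesian_product by (intro sum.cong) (auto simp: exp_add)
  then show ?thesis
    unfolding gibbs_def pf_pair
    by (simp add: sum_distrib_left sum_divide_distrib power2_eq_square)
qed

lemma DERIV_ln_pf:
  assumes "finite S" "S \<noteq> {}"
    and "\<And>s. s \<in> S \<Longrightarrow> ((\<lambda>t. H t s) has_real_derivative H' s) (at t)"
  shows "((\<lambda>t. ln (pf S (H t))) has_real_derivative gibbs S (H t) H') (at t)"
proof -
  have "((\<lambda>t. \<Sum>s\<in>S. exp (H t s)) has_real_derivative (\<Sum>s\<in>S. exp (H t s) * H' s)) (at t)"
    by (rule DERIV_sum) (rule DERIV_fun_exp, rule assms)
  then have "((\<lambda>t. ln (pf S (H t))) has_real_derivative
      inverse (pf S (H t)) * (\<Sum>s\<in>S. exp (H t s) * H' s)) (at t)"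
    unfolding pf_def [abs_def]
    by (intro DERIV_chain2[OF DERIV_ln]) (use pf_pos[OF assms(1,2), of "H t"] in \<open>auto simp: pf_def\<close>)
  then show ?thesis by (simp add: gibbs_def divide_inverse mult.commute)
qed

text \<open>Quotient rule; the outcome is the Gibbs covariance of \<open>f\<close> and
  \<open>H'\<close>.\<close>

lemma DERIV_gibbs:
  assumes "finite S" "S \<noteq> {}"
    and "\<And>s. s \<in> S \<Longrightarrow> ((\<lambda>t. H t s) has_real_derivative H' s) (at t)"
  shows "((\<lambda>t. gibbs S (H t) f) has_real_derivative
    gibbs S (H t) (\<lambda>s. f s * H' s) - gibbs S (H t) f * gibbs S (H t) H') (at t)"
proof -
  have Z: "pf S (H t) \<noteq> 0" using pf_pos[OF assms(1,2), of "H t"] by simp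
  have 1: "((\<lambda>t. pf S (H t)) has_real_derivative (\<Sum>s\<in>S. exp (H t s) * H' s)) (at t)"
    unfolding pf_def by (rule DERIV_sum) (rule DERIV_fun_exp, rule assms)
  have 2: "((\<lambda>t. \<Sum>s\<in>S. exp (H t s) * f s) has_real_derivative
      (\<Sum>s\<in>S. exp (H t s) * H' s * f s)) (at t)"
    by (rule DERIV_sum) (intro DERIV_cmult_right DERIV_fun_exp assms)
  show ?thesis
    unfolding gibbs_def
    by (rule DERIV_cong[OF DERIV_divide[OF 2 1 Z]]) (use Z in \<open>simp add: field_simps\<close>)
qed

lemma measurable_pf:
  assumes "\<And>s. s \<in> S \<Longrightarrow> (\<lambda>x. H x s) \<in> borel_measurable M"
  shows "(\<lambda>x. pf S (H x)) \<in> borel_measurable M"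
  unfolding pf_def
  by (intro borel_measurable_sum measurable_compose[OF assms borel_measurable_exp])

lemma measurable_gibbs:
  assumes "\<And>s. s \<in> S \<Longrightarrow> (\<lambda>x. H x s) \<in> borel_measurable M"
    and "\<And>s. s \<in> S \<Longrightarrow> (\<lambda>x. f x s) \<in> borel_measurable M"
  shows "(\<lambda>x. gibbs S (H x) (f x)) \<in> borel_measurable M"
  unfolding gibbs_def
  by (intro borel_measurable_divide measurable_pf borel_measurable_sum borel_measurable_times
      measurable_compose[OF assms(1) borel_measurable_exp] assms)

lemma continuous_gibbs:
  assumes "finite S" "S \<noteq> {}" "\<And>s. s \<in> S \<Longrightarrow> continuous_on A (\<lambda>y. H y s)"
  shows "continuous_on A (\<lambda>y. gibbs S (H y) f)"
  unfolding gibbs_def pf_def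
  by (intro continuous_intros assms ballI) (use pf_pos[OF assms(1,2)] in \<open>auto simp: pf_def less_le\<close>)

lemma abs_ln_pf_le:
  assumes "finite S" "S \<noteq> {}" "\<And>s. s \<in> S \<Longrightarrow> \<bar>H s\<bar> \<le> B"
  shows "\<bar>ln (pf S H)\<bar> \<le> ln (card S) + B"
proof -
  have c: "real (card S) \<ge> 1" using assms by (simp add: Suc_leI card_gt_0_iff)
  have "pf S H \<le> (\<Sum>s\<in>S. exp B)" unfolding pf_def using assms(3) by (intro sum_mono) (auto simp: abs_le_iff)
  then have "ln (pf S H) \<le> ln (card S * exp B)" using pf_pos[OF assms(1,2), of H] by simp
  moreover have "(\<Sum>s\<in>S. exp (-B)) \<le> pf S H" unfolding pf_def using assms(3)
    by (intro sum_mono) (force simp: abs_le_iff)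
  then have "ln (card S * exp (-B)) \<le> ln (pf S H)" using c by (subst ln_le_cancel_iff) (auto simp: pf_pos[OF assms(1,2)])
  moreover have "ln (real (card S)) \<ge> 0" using c by simp
  moreover have "ln (card S * exp B) = ln (card S) + B" "ln (card S * exp (-B)) = ln (card S) - B"
    using c by (simp_all add: ln_mult)
  ultimately show ?thesis by linarith
qed

lemma measurable_linear_energy:
  "(\<lambda>x. e + (\<Sum>k\<in>K. c k * x k)) \<in> borel_measurable (gaussP K)"
  by (intro borel_measurable_add borel_measurable_sum borel_measurable_times gaussP_measurable_coord) auto

lemma integrable_gibbs:
  assumes "finite S" "S \<noteq> {}" 
  shows "integrable (gaussP K) (\<lambda>x. gibbs S (\<lambda>s. e s + (\<Sum>k\<in>K. c s k * x k)) f)"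
proof (rule gauss_prod.P.integrable_const_bound[where B = "\<Sum>s\<in>S. \<bar>f s\<bar>"])
  have "\<bar>f s\<bar> \<le> (\<Sum>s\<in>S. \<bar>f s\<bar>)" if "s \<in> S" for s
    using that assms by (intro member_le_sum) auto
  then show "AE x in gaussP K. norm (gibbs S (\<lambda>s. e s + (\<Sum>k\<in>K. c s k * x k)) f) \<le> (\<Sum>s\<in>S. \<bar>f s\<bar>)"
    unfolding real_norm_def by (intro AE_I2 abs_gibbs_le assms)
  show "(\<lambda>x. gibbs S (\<lambda>s. e s + (\<Sum>k\<in>K. c s k * x k)) f) \<in> borel_measurable (gaussP K)"
    by (intro measurable_gibbs measurable_linear_energy borel_measurable_const)
qed

text \<open>The logarithm grows at most linearly in the absolute values of the coordinates, since
  each energy does.\<close>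

lemma integrable_ln_pf:
  assumes "finite S" "S \<noteq> {}" "finite K"
  shows "integrable (gaussP K) (\<lambda>x. ln (pf S (\<lambda>s. e s + (\<Sum>k\<in>K. c s k * x k))))"
proof -
  define B where "B = (\<lambda>x. (\<Sum>s\<in>S. \<bar>e s\<bar>) + (\<Sum>k\<in>K. (\<Sum>s\<in>S. \<bar>c s k\<bar>) * \<bar>x k\<bar>))"
  have iB: "integrable (gaussP K) B"
    unfolding B_def
    by (intro Bochner_Integration.integrable_add Bochner_Integration.integrable_sum
        integrable_mult_right gaussP_integrable_abs) auto
  have HB: "\<bar>e s + (\<Sum>k\<in>K. c s k * x k)\<bar> \<le> B x" if s: "s \<in> S" for s x
  proof -
    have "\<bar>e s\<bar> \<le> (\<Sum>s\<in>S. \<bar>e s\<bar>)" using s assms by (intro member_le_sum) auto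
    moreover have "\<bar>\<Sum>k\<in>K. c s k * x k\<bar> \<le> (\<Sum>k\<in>K. (\<Sum>s\<in>S. \<bar>c s k\<bar>) * \<bar>x k\<bar>)"
    proof (rule order_trans[OF sum_abs], rule sum_mono)
      fix k
      have "\<bar>c s k\<bar> \<le> (\<Sum>s\<in>S. \<bar>c s k\<bar>)" 
        using s assms by (intro member_le_sum[of s S "\<lambda>s. \<bar>c s k\<bar>"]) auto
      then show "\<bar>c s k * x k\<bar> \<le> (\<Sum>s\<in>S. \<bar>c s k\<bar>) * \<bar>x k\<bar>"
        by (simp add: abs_mult mult_right_mono)
    qed
    ultimately show ?thesis unfolding B_def by linarith
  qed
  show ?thesis
  proof (rule Bochner_Integration.integrable_bound)
    show "integrable (gaussP K) (\<lambda>x. ln (card S) + B x)" using iB by simp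
    show "(\<lambda>x. ln (pf S (\<lambda>s. e s + (\<Sum>k\<in>K. c s k * x k)))) \<in> borel_measurable (gaussP K)"
      by (intro borel_measurable_ln measurable_pf measurable_linear_energy)
    show "AE x in gaussP K. norm (ln (pf S (\<lambda>s. e s + (\<Sum>k\<in>K. c s k * x k)))) \<le> norm (ln (card S) + B x)"
      unfolding real_norm_def by (intro AE_I2 order_trans[OF abs_ln_pf_le abs_ge_self] assms HB)
  qed
qed

text \<open>The derivative of a Gibbs average in \<open>x k\<close> is the covariance of the
  observable with the coefficient \<open>c s k\<close>, so integration by parts trades the Gaussian
  factor for a bounded quantity.\<close>

lemma gaussP_gibbs_ibp:
  fixes c :: "'s \<Rightarrow> 'i \<Rightarrow> real" and e f :: "'s \<Rightarrow> real"
  assumes S: "finite S" "S \<noteq> {}" and K: "finite K" "k \<in> K"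
  defines "H \<equiv> \<lambda>x s. e s + (\<Sum>k\<in>K. c s k * x k)"
  shows "(\<integral>x. x k * gibbs S (H x) f \<partial>gaussP K) =
    (\<integral>x. gibbs S (H x) (\<lambda>s. f s * c s k) - gibbs S (H x) f * gibbs S (H x) (\<lambda>s. c s k) \<partial>gaussP K)"
proof -
  define A where "A = (\<Sum>s\<in>S. \<bar>f s\<bar>)"
  define B where "B = (\<Sum>s\<in>S. \<bar>c s k\<bar>)"
  have A: "\<bar>f s\<bar> \<le> A" if "s \<in> S" for s
    unfolding A_def using that S by (intro member_le_sum) auto
  have B: "\<bar>c s k\<bar> \<le> B" if "s \<in> S" for s
    unfolding B_def using that S by (intro member_le_sum[of s S "\<lambda>s. \<bar>c s k\<bar>"]) auto
  have AB: "\<bar>f s * c s k\<bar> \<le> A * B" if "s \<in> S" for s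
    using A[OF that] B[OF that] by (simp add: abs_mult mult_mono)
  have H_deriv: "((\<lambda>y. H (x(k := y)) s) has_real_derivative c s k) (at y)" for x y s
  proof -
    have "H (x(k := y)) s = e s + (\<Sum>j\<in>K-{k}. c s j * x j) + c s k * y" for y
      unfolding H_def using K by (simp add: sum.remove[of K k])
    then show ?thesis by (auto intro!: derivative_eq_intros)
  qed
  have H_cont: "continuous_on UNIV (\<lambda>y. H (x(k := y)) s)" for x s
    using H_deriv by (meson DERIV_isCont continuous_at_imp_continuous_on)
  have H_meas: "(\<lambda>x. H x s) \<in> borel_measurable (gaussP K)" for s
    unfolding H_def by (rule measurable_linear_energy)
  have gA: "\<bar>gibbs S (H x) f\<bar> \<le> A" and gB: "\<bar>gibbs S (H x) (\<lambda>s. c s k)\<bar> \<le> B"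
    and gAB: "\<bar>gibbs S (H x) (\<lambda>s. f s * c s k)\<bar> \<le> A * B" for x
    by (rule abs_gibbs_le[OF S A] abs_gibbs_le[OF S B] abs_gibbs_le[OF S AB]; assumption)+
  show ?thesis
  proof (rule gaussP_ibp[OF K, where C = A and C' = "A * B + A * B"])
    fix x :: "'i \<Rightarrow> real" and y
    show "((\<lambda>y. gibbs S (H (x(k := y))) f) has_real_derivative
        gibbs S (H (x(k := y))) (\<lambda>s. f s * c s k) - gibbs S (H (x(k := y))) f * gibbs S (H (x(k := y))) (\<lambda>s. c s k)) (at y)"
      by (rule DERIV_gibbs[OF S H_deriv])
    show "continuous_on UNIV (\<lambda>y. gibbs S (H (x(k := y))) (\<lambda>s. f s * c s k)
        - gibbs S (H (x(k := y))) f * gibbs S (H (x(k := y))) (\<lambda>s. c s k))"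
      by (intro continuous_intros continuous_gibbs S H_cont)
    show "\<bar>gibbs S (H x) f\<bar> \<le> A" by (rule gA)
    have "\<bar>gibbs S (H x) f * gibbs S (H x) (\<lambda>s. c s k)\<bar> \<le> A * B"
      unfolding abs_mult using gA gB by (rule mult_mono) (auto intro: order_trans[OF abs_ge_zero gA])
    with gAB[of x] show "\<bar>gibbs S (H x) (\<lambda>s. f s * c s k) - gibbs S (H x) f * gibbs S (H x) (\<lambda>s. c s k)\<bar> \<le> A * B + A * B"
      by linarith
  qed (intro borel_measurable_diff borel_measurable_times measurable_gibbs H_meas borel_measurable_const)+
qed

text \<open>The time derivative of the energy contains the unbounded factors \<open>x k\<close>;
  integration by parts removes them and leaves the kernel \<Gamma>, its diagonal averaged over one
  replica minus its average over two. The bounds on e' and c', uniform in t, supply the dominating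
  function.\<close>

lemma gaussian_interpolation:
  fixes c c' :: "real \<Rightarrow> 's \<Rightarrow> 'i \<Rightarrow> real" and e e' :: "real \<Rightarrow> 's \<Rightarrow> real"
  assumes S: "finite S" "S \<noteq> {}" and K: "finite K"
    and e: "\<And>t s. ((\<lambda>t. e t s) has_real_derivative e' t s) (at t)"
    and c: "\<And>t s k. ((\<lambda>t. c t s k) has_real_derivative c' t s k) (at t)"
    and e'_le: "\<And>t s. s \<in> S \<Longrightarrow> \<bar>e' t s\<bar> \<le> A" and c'_le: "\<And>t s k. s \<in> S \<Longrightarrow> k \<in> K \<Longrightarrow> \<bar>c' t s k\<bar> \<le> A"
  defines "H \<equiv> \<lambda>t x s. e t s + (\<Sum>k\<in>K. c t s k * x k)"
    and "\<Gamma> \<equiv> \<lambda>t s s'. \<Sum>k\<in>K. c' t s k * c t s' k"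
  shows "((\<lambda>t. \<integral>x. ln (pf S (H t x)) \<partial>gaussP K) has_real_derivative
    (\<integral>x. gibbs S (H t x) (\<lambda>s. e' t s + \<Gamma> t s s)
        - gibbs S (H t x) (\<lambda>s. gibbs S (H t x) (\<Gamma> t s)) \<partial>gaussP K)) (at t)"
proof -
  define H' where "H' = (\<lambda>t x s. e' t s + (\<Sum>k\<in>K. c' t s k * x k))"
  have H: "((\<lambda>t. H t x s) has_real_derivative H' t x s) (at t)" for t x s
    unfolding H_def H'_def
    by (intro DERIV_add e DERIV_sum) (intro DERIV_cmult_right c)
  have H_meas: "(\<lambda>x. H t x s) \<in> borel_measurable (gaussP K)" for t s
    unfolding H_def by (rule measurable_linear_energy)
  have H'_meas: "(\<lambda>x. H' t x s) \<in> borel_measurable (gaussP K)" for t s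
    unfolding H'_def by (rule measurable_linear_energy)
  \<comment> \<open>A product of two one-replica averages is an iterated average over two
    independent replicas.\<close>
  have ptw: "gibbs S (H t x) (e' t) + (\<Sum>k\<in>K. gibbs S (H t x) (\<lambda>s. c' t s k * c t s k)
         - gibbs S (H t x) (\<lambda>s. c' t s k) * gibbs S (H t x) (\<lambda>s. c t s k)) =
      gibbs S (H t x) (\<lambda>s. e' t s + \<Gamma> t s s) - gibbs S (H t x) (\<lambda>s. gibbs S (H t x) (\<Gamma> t s))" for x
  proof -
    have "gibbs S (H t x) (\<lambda>s. gibbs S (H t x) (\<Gamma> t s)) =
        (\<Sum>k\<in>K. gibbs S (H t x) (\<lambda>s. c' t s k) * gibbs S (H t x) (\<lambda>s. c t s k))"
      unfolding \<Gamma>_def by (simp add: gibbs_sum gibbs_cmult gibbs_cmult[of _ _ "gibbs _ _ _", simplified mult.commute])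
    then show ?thesis
      by (simp add: gibbs_add \<Gamma>_def gibbs_sum sum_subtractf)
  qed
  have "((\<lambda>t. \<integral>x. ln (pf S (H t x)) \<partial>gaussP K) has_real_derivative
    (\<integral>x. gibbs S (H t x) (H' t x) \<partial>gaussP K)) (at t)"
  proof (rule has_real_derivative_integral[where w = "\<lambda>x. A + (\<Sum>k\<in>K. A * \<bar>x k\<bar>)"])
    show "integrable (gaussP K) (\<lambda>x. ln (pf S (H t x)))" for t
      unfolding H_def by (rule integrable_ln_pf[OF S K])
    show "integrable (gaussP K) (\<lambda>x. A + (\<Sum>k\<in>K. A * \<bar>x k\<bar>))"
      by (intro Bochner_Integration.integrable_add Bochner_Integration.integrable_sum
          integrable_mult_right gaussP_integrable_abs) auto
    show "(\<lambda>x. gibbs S (H t x) (H' t x)) \<in> borel_measurable (gaussP K)"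
      by (intro measurable_gibbs H_meas H'_meas)
    show "((\<lambda>t. ln (pf S (H t x))) has_real_derivative gibbs S (H t x) (H' t x)) (at t)" for t x
      by (rule DERIV_ln_pf[OF S H])
    show "\<bar>gibbs S (H t x) (H' t x)\<bar> \<le> A + (\<Sum>k\<in>K. A * \<bar>x k\<bar>)" for t x
    proof (rule abs_gibbs_le[OF S])
      fix s assume s: "s \<in> S"
      have "\<bar>\<Sum>k\<in>K. c' t s k * x k\<bar> \<le> (\<Sum>k\<in>K. A * \<bar>x k\<bar>)"
        by (rule order_trans[OF sum_abs], rule sum_mono)
           (use c'_le[OF s] in \<open>auto simp: abs_mult intro!: mult_right_mono\<close>)
      then show "\<bar>H' t x s\<bar> \<le> A + (\<Sum>k\<in>K. A * \<bar>x k\<bar>)"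
        unfolding H'_def using e'_le[OF s, of t] by linarith
    qed
  qed
  also have "(\<integral>x. gibbs S (H t x) (H' t x) \<partial>gaussP K) =
      (\<integral>x. gibbs S (H t x) (e' t) + (\<Sum>k\<in>K. x k * gibbs S (H t x) (\<lambda>s. c' t s k)) \<partial>gaussP K)"
    by (simp add: H'_def gibbs_add gibbs_sum gibbs_cmult[symmetric] mult.commute)
  also have "\<dots> = (\<integral>x. gibbs S (H t x) (e' t) \<partial>gaussP K)
      + (\<Sum>k\<in>K. \<integral>x. x k * gibbs S (H t x) (\<lambda>s. c' t s k) \<partial>gaussP K)"
  proof (subst Bochner_Integration.integral_add)
    show i: "integrable (gaussP K) (\<lambda>x. \<Sum>k\<in>K. x k * gibbs S (H t x) (\<lambda>s. c' t s k))"
      by (intro Bochner_Integration.integrable_sum integrable_times_coord[where C = A] K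
          measurable_gibbs H_meas borel_measurable_const abs_gibbs_le S c'_le)
    show "integrable (gaussP K) (\<lambda>x. gibbs S (H t x) (e' t))"
      unfolding H_def by (rule integrable_gibbs[OF S])
  qed (subst Bochner_Integration.integral_sum,
      auto intro!: integrable_times_coord[where C = A] K
          measurable_gibbs H_meas borel_measurable_const abs_gibbs_le S c'_le)
  also have "(\<Sum>k\<in>K. \<integral>x. x k * gibbs S (H t x) (\<lambda>s. c' t s k) \<partial>gaussP K) =
      (\<Sum>k\<in>K. \<integral>x. gibbs S (H t x) (\<lambda>s. c' t s k * c t s k)
         - gibbs S (H t x) (\<lambda>s. c' t s k) * gibbs S (H t x) (\<lambda>s. c t s k) \<partial>gaussP K)"
    unfolding H_def by (intro sum.cong refl gaussP_gibbs_ibp S K)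
  also have "(\<integral>x. gibbs S (H t x) (e' t) \<partial>gaussP K) + \<dots> =
     (\<integral>x. gibbs S (H t x) (e' t) + (\<Sum>k\<in>K. gibbs S (H t x) (\<lambda>s. c' t s k * c t s k)
         - gibbs S (H t x) (\<lambda>s. c' t s k) * gibbs S (H t x) (\<lambda>s. c t s k)) \<partial>gaussP K)"
  proof -
    have "integrable (gaussP K) (\<lambda>x. gibbs S (H t x) f * gibbs S (H t x) g)" for f g
    proof (rule gauss_prod.P.integrable_const_bound)
      have *: "\<bar>f s\<bar> \<le> (\<Sum>s\<in>S. \<bar>f s\<bar>)" if "s \<in> S" for s and f :: "'s \<Rightarrow> real"
        using that S by (intro member_le_sum) auto
      show "AE x in gaussP K. norm (gibbs S (H t x) f * gibbs S (H t x) g)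
          \<le> (\<Sum>s\<in>S. \<bar>f s\<bar>) * (\<Sum>s\<in>S. \<bar>g s\<bar>)"
        unfolding real_norm_def abs_mult by (intro AE_I2 mult_mono abs_gibbs_le S * sum_nonneg) auto
    qed (intro borel_measurable_times measurable_gibbs H_meas borel_measurable_const)
    moreover have "integrable (gaussP K) (\<lambda>x. gibbs S (H t x) f)" for f
      unfolding H_def by (rule integrable_gibbs[OF S])
    ultimately show ?thesis
      by simp
  qed
  finally show ?thesis unfolding ptw .
qed

section \<open>Gaussian concentration\<close>

text \<open>Symmetrisation: for an independent copy Y of X, the exponential moment of s (F X - F Y)
  is at most that of s l (X - Y), and Jensen replaces F Y by its mean. This loses a factor 2 against
  the optimal exponent s^2 l^2 / 2, which is harmless for summable tails.\<close>

lemma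
  fixes F :: "real \<Rightarrow> real"
  assumes lip: "\<And>y z. \<bar>F y - F z\<bar> \<le> l * \<bar>y - z\<bar>"
  shows lipschitz_gauss_integrable: "integrable gauss F"
    and lipschitz_gauss_exp_integrable: "integrable gauss (\<lambda>x. exp (s * F x))"
    and lipschitz_gauss_exp_le: "(\<integral>x. exp (s * (F x - (\<integral>y. F y \<partial>gauss))) \<partial>gauss) \<le> exp (s\<^sup>2 * l\<^sup>2)"
proof -
  have l: "l \<ge> 0" using lip[of 1 0] by auto
  have "l-lipschitz_on UNIV F"
    using lip l by (auto intro!: lipschitz_onI simp: dist_real_def)
  then have "continuous_on UNIV F" by (rule lipschitz_on_continuous_on)
  then have [measurable]: "F \<in> borel_measurable borel" by (rule borel_measurable_continuous_onI)
  have F_le: "\<bar>F y\<bar> \<le> \<bar>F 0\<bar> + l * \<bar>y\<bar>" for y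
    using lip[of y 0] by simp
  show intF: "integrable gauss F"
  proof (rule Bochner_Integration.integrable_bound)
    show "integrable gauss (\<lambda>y. \<bar>F 0\<bar> + l * \<bar>y\<bar>)" using gauss_integrable_abs by simp
    show "AE x in gauss. norm (F x) \<le> norm (\<bar>F 0\<bar> + l * \<bar>x\<bar>)"
      unfolding real_norm_def by (intro AE_I2 order_trans[OF F_le abs_ge_self])
  qed simp
  have int: "integrable gauss (\<lambda>x. exp (s * F x))" for s
  proof (rule Bochner_Integration.integrable_bound)
    define a where "a = \<bar>s\<bar> * l"
    show "integrable gauss (\<lambda>y. exp (\<bar>s\<bar> * \<bar>F 0\<bar>) * (exp (a * y) + exp ((-a) * y)))"
      using gauss_exp(1)[of a] gauss_exp(1)[of "-a"] by simp
    have "exp (s * F x) \<le> exp (\<bar>s\<bar> * \<bar>F 0\<bar>) * (exp (a * x) + exp ((-a) * x))" for x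
    proof -
      have "s * F x \<le> \<bar>s\<bar> * \<bar>F x\<bar>" by (metis abs_ge_self abs_mult)
      also have "\<dots> \<le> \<bar>s\<bar> * (\<bar>F 0\<bar> + l * \<bar>x\<bar>)" by (intro mult_left_mono F_le) auto
      finally have "exp (s * F x) \<le> exp (\<bar>s\<bar> * \<bar>F 0\<bar>) * exp (a * \<bar>x\<bar>)"
        by (simp add: exp_add[symmetric] a_def algebra_simps)
      also have "exp (a * \<bar>x\<bar>) \<le> exp (a * x) + exp ((-a) * x)"
        by (cases "x \<ge> 0") auto
      finally show ?thesis by simp
    qed
    then show "AE x in gauss. norm (exp (s * F x)) \<le> norm (exp (\<bar>s\<bar> * \<bar>F 0\<bar>) * (exp (a * x) + exp ((-a) * x)))"
      by (intro AE_I2) (auto intro: order_trans[OF _ abs_ge_self])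
  qed simp
  then show "integrable gauss (\<lambda>x. exp (s * F x))" .
  define m where "m = (\<integral>y. F y \<partial>gauss)"
  define A where "A = (\<integral>x. exp (s * F x) \<partial>gauss)"
  define B where "B = (\<integral>x. exp ((-s) * F x) \<partial>gauss)"
  \<comment> \<open>Jensen for the copy, via the tangent of exp at - s m.\<close>
  have B: "exp (- s * m) \<le> B"
  proof -
    have "(\<integral>y. exp (- s * m) * (1 + s * m) - exp (- s * m) * s * F y \<partial>gauss) \<le> B"
      unfolding B_def
    proof (rule integral_mono)
      fix y
      have "1 + (- s * F y + s * m) \<le> exp (- s * F y + s * m)" by (rule exp_ge_add_one_self)
      then have "exp (- s * m) * (1 + (- s * F y + s * m)) \<le> exp (- s * m) * exp (- s * F y + s * m)"
        by (intro mult_left_mono) auto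
      then show "exp (- s * m) * (1 + s * m) - exp (- s * m) * s * F y \<le> exp ((-s) * F y)"
        by (simp add: exp_add[symmetric] algebra_simps)
    qed (use intF int[of "-s"] in simp_all)
    then show ?thesis using intF by (simp add: m_def[symmetric] algebra_simps)
  qed
  \<comment> \<open>Adding the integrand with x and y exchanged gives 2 cosh (s (F x - F y)). As
    cosh is even and increasing in the absolute value, the Lipschitz bound can be inserted
    pointwise.\<close>
  have "2 * (A * B) = (\<integral>x. (\<integral>y. exp (s * F x) * exp ((-s) * F y) + exp ((-s) * F x) * exp (s * F y) \<partial>gauss) \<partial>gauss)"
    using int[of s] int[of "-s"] by (simp add: A_def B_def)
  also have "\<dots> \<le> (\<integral>x. (\<integral>y. exp (s * l * x) * exp (-(s * l) * y) + exp (-(s * l) * x) * exp (s * l * y) \<partial>gauss) \<partial>gauss)"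
  proof (intro integral_mono)
    fix x y
    have "cosh (s * F x - s * F y) \<le> cosh (s * l * x - s * l * y)"
    proof -
      have "\<bar>s * F x - s * F y\<bar> = \<bar>s\<bar> * \<bar>F x - F y\<bar>" by (simp add: abs_mult[symmetric] algebra_simps)
      also have "\<dots> \<le> \<bar>s\<bar> * (l * \<bar>x - y\<bar>)" by (intro mult_left_mono lip) auto
      also have "\<dots> = \<bar>s * l * (x - y)\<bar>" using l by (simp add: abs_mult)
      also have "\<dots> = \<bar>s * l * x - s * l * y\<bar>" by (simp add: algebra_simps)
      finally have "cosh \<bar>s * F x - s * F y\<bar> \<le> cosh \<bar>s * l * x - s * l * y\<bar>"
        by (subst cosh_real_nonneg_le_iff) auto
      then show ?thesis by simp
    qed
    then show "exp (s * F x) * exp ((-s) * F y) + exp ((-s) * F x) * exp (s * F y) \<le>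
      exp (s * l * x) * exp (-(s * l) * y) + exp (-(s * l) * x) * exp (s * l * y)"
      by (simp add: cosh_def exp_add[symmetric])
  qed (use int[of s] int[of "-s"] gauss_exp(1)[of "s * l"] gauss_exp(1)[of "-(s * l)"] in simp_all)
  also have "\<dots> = 2 * exp (s\<^sup>2 * l\<^sup>2)"
  proof -
    have "exp (s\<^sup>2 * l\<^sup>2 / 2) * exp (s\<^sup>2 * l\<^sup>2 / 2) = exp (s\<^sup>2 * l\<^sup>2)"
      by (simp flip: exp_add)
    then show ?thesis
      using gauss_exp[of "s * l"] gauss_exp[of "-(s * l)"] by (simp add: power_mult_distrib)
  qed
  finally have AB: "A * B \<le> exp (s\<^sup>2 * l\<^sup>2)" by simp
  have "(\<integral>x. exp (s * (F x - m)) \<partial>gauss) = A * exp (- s * m)"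
    by (simp add: A_def right_diff_distrib exp_diff exp_minus divide_inverse)
  also have "\<dots> \<le> A * B" using B by (intro mult_left_mono) (auto simp: A_def)
  finally show "(\<integral>x. exp (s * (F x - (\<integral>y. F y \<partial>gauss))) \<partial>gauss) \<le> exp (s\<^sup>2 * l\<^sup>2)"
    using AB by (simp add: m_def)
qed

text \<open>Telescoping over the coordinates, set to 0 one after another, bounds F by a constant
  plus l times the sum of their absolute values.\<close>

lemma coord_lipschitz_gaussP_integrable:
  fixes F :: "('i \<Rightarrow> real) \<Rightarrow> real"
  assumes I: "finite I" and meas: "F \<in> borel_measurable (gaussP I)"
    and lip: "\<And>x i y z. i \<in> I \<Longrightarrow> \<bar>F (x(i := y)) - F (x(i := z))\<bar> \<le> l * \<bar>y - z\<bar>"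
  shows "integrable (gaussP I) F"
proof (rule Bochner_Integration.integrable_bound)
  show "integrable (gaussP I) (\<lambda>x. \<bar>F (\<lambda>k\<in>I. 0)\<bar> + (\<Sum>k\<in>I. l * \<bar>x k\<bar>))"
    by (intro Bochner_Integration.integrable_add Bochner_Integration.integrable_sum
          integrable_mult_right gaussP_integrable_abs) auto
  have *: "\<bar>F x - F (\<lambda>k. if k \<in> J then 0 else x k)\<bar> \<le> (\<Sum>k\<in>J. l * \<bar>x k\<bar>)" if "finite J" "J \<subseteq> I" for x J
    using that
  proof (induction J)
    case (insert i J)
    let ?x = "\<lambda>k. if k \<in> J then 0 else x k"
    have "?x(i := x i) = ?x" "?x(i := 0) = (\<lambda>k. if k \<in> insert i J then 0 else x k)"
      using insert by (auto simp: fun_eq_iff)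
    then have "\<bar>F ?x - F (\<lambda>k. if k \<in> insert i J then 0 else x k)\<bar> \<le> l * \<bar>x i\<bar>"
      using lip[of i ?x "x i" 0] insert by simp
    then show ?case using insert by (simp add: insert.hyps)
  qed simp
  show "AE x in gaussP I. norm (F x) \<le> norm (\<bar>F (\<lambda>k\<in>I. 0)\<bar> + (\<Sum>k\<in>I. l * \<bar>x k\<bar>))"
  proof (rule AE_I2)
    fix x assume "x \<in> space (gaussP I)"
    then have "(\<lambda>k. if k \<in> I then 0 else x k) = (\<lambda>k\<in>I. 0)"
      by (auto simp: space_PiM PiE_def extensional_def fun_eq_iff)
    then show "norm (F x) \<le> norm (\<bar>F (\<lambda>k\<in>I. 0)\<bar> + (\<Sum>k\<in>I. l * \<bar>x k\<bar>))"
      using *[OF I, of x] by simp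
  qed
qed (rule meas)

text \<open>Tensorisation by induction on I: averaging out one coordinate keeps the Lipschitz
  constant in the others, and each coordinate contributes a factor exp (s^2 l^2). Nonnegative
  integrals avoid a separate proof that the exponential is integrable on the product.\<close>

lemma coord_lipschitz_gaussP_exp_le:
  fixes F :: "('i \<Rightarrow> real) \<Rightarrow> real"
  assumes "finite I" "F \<in> borel_measurable (gaussP I)"
    and "\<And>x i y z. i \<in> I \<Longrightarrow> \<bar>F (x(i := y)) - F (x(i := z))\<bar> \<le> l * \<bar>y - z\<bar>"
  shows "(\<integral>\<^sup>+x. ennreal (exp (s * (F x - (\<integral>y. F y \<partial>gaussP I)))) \<partial>gaussP I)
    \<le> ennreal (exp (s\<^sup>2 * l\<^sup>2 * card I))"
  using assms
proof (induction I arbitrary: F)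
  case empty
  have "(\<integral>y. F y \<partial>gaussP {}) = F (\<lambda>x. undefined)"
    by (simp add: PiM_empty lebesgue_integral_count_space_finite)
  then show ?case by (simp add: PiM_empty nn_integral_count_space_finite)
next
  case (insert i I)
  note lip = insert.prems(2)
  note [measurable] = insert.prems(1)
  define G where "G = (\<lambda>x. \<integral>y. F (x(i := y)) \<partial>gauss)"
  have F_int: "integrable (gaussP (insert i I)) F"
    by (rule coord_lipschitz_gaussP_integrable[OF _ insert.prems]) (use insert.hyps in auto)
  have EF: "(\<integral>x. F x \<partial>gaussP (insert i I)) = (\<integral>x. G x \<partial>gaussP I)"
    unfolding G_def by (rule gauss_prod.product_integral_insert[OF insert.hyps F_int])
  have upd: "(\<lambda>(x, y). x(i := y)) \<in> measurable (gaussP I \<Otimes>\<^sub>M gauss) (gaussP (insert i I))"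
    by (rule measurable_add_dim)
  have G_meas: "G \<in> borel_measurable (gaussP I)"
    unfolding G_def
    by (rule gauss.borel_measurable_lebesgue_integral)
       (use measurable_compose[OF upd insert.prems(1)] in \<open>simp add: split_def\<close>)
  have lip1: "\<bar>F (x(i := y)) - F (x(i := z))\<bar> \<le> l * \<bar>y - z\<bar>" for x y z
    by (rule lip) simp
  have int1: "integrable gauss (\<lambda>y. F (x(i := y)))" for x
    by (rule lipschitz_gauss_integrable[OF lip1])
  have G_lip: "\<bar>G (x(j := y)) - G (x(j := z))\<bar> \<le> l * \<bar>y - z\<bar>" if j: "j \<in> I" for x j y z
  proof -
    have ij: "i \<noteq> j" using j insert.hyps by auto
    have "G (x(j := y)) - G (x(j := z)) = (\<integral>w. F (x(j := y, i := w)) - F (x(j := z, i := w)) \<partial>gauss)"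
      unfolding G_def using int1 by simp
    also have "\<bar>\<dots>\<bar> \<le> (\<integral>w. \<bar>F (x(j := y, i := w)) - F (x(j := z, i := w))\<bar> \<partial>gauss)"
      by (rule integral_abs_bound)
    also have "\<dots> \<le> (\<integral>w. l * \<bar>y - z\<bar> \<partial>gauss)"
    proof (rule integral_mono)
      fix w
      show "\<bar>F (x(j := y, i := w)) - F (x(j := z, i := w))\<bar> \<le> l * \<bar>y - z\<bar>"
        using lip[of j "x(i := w)" y z] j unfolding fun_upd_twist[OF ij] by blast
    qed (use int1 in auto)
    finally show ?thesis by simp
  qed
  let ?m = "\<integral>x. G x \<partial>gaussP I"
  have "(\<integral>\<^sup>+x. ennreal (exp (s * (F x - ?m))) \<partial>gaussP (insert i I)) =
      (\<integral>\<^sup>+x. \<integral>\<^sup>+y. ennreal (exp (s * (F (x(i := y)) - ?m))) \<partial>gauss \<partial>gaussP I)"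
    by (rule gauss_prod.product_nn_integral_insert) (use insert.hyps in auto)
  also have "\<dots> = (\<integral>\<^sup>+x. ennreal (exp (s * (G x - ?m))) *
      (\<integral>\<^sup>+y. ennreal (exp (s * (F (x(i := y)) - G x))) \<partial>gauss) \<partial>gaussP I)"
  proof (rule nn_integral_cong)
    fix x
    have "(\<lambda>y. F (x(i := y))) \<in> borel_measurable gauss" using int1[of x] by auto
    then show "(\<integral>\<^sup>+y. ennreal (exp (s * (F (x(i := y)) - ?m))) \<partial>gauss) =
      ennreal (exp (s * (G x - ?m))) * (\<integral>\<^sup>+y. ennreal (exp (s * (F (x(i := y)) - G x))) \<partial>gauss)"
      by (subst nn_integral_cmult[symmetric])
         (auto simp: ennreal_mult[symmetric] exp_add[symmetric] algebra_simps)
  qed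
  also have "\<dots> \<le> (\<integral>\<^sup>+x. ennreal (exp (s * (G x - ?m))) * ennreal (exp (s\<^sup>2 * l\<^sup>2)) \<partial>gaussP I)"
  proof (intro nn_integral_mono mult_left_mono)
    fix x
    have "integrable gauss (\<lambda>y. exp (s * F (x(i := y))) * exp (- (s * G x)))"
      by (rule integrable_mult_left) (rule lipschitz_gauss_exp_integrable[OF lip1])
    then have "integrable gauss (\<lambda>y. exp (s * (F (x(i := y)) - G x)))"
      by (simp add: exp_add[symmetric] right_diff_distrib)
    then have "(\<integral>\<^sup>+y. ennreal (exp (s * (F (x(i := y)) - G x))) \<partial>gauss) =
        ennreal (\<integral>y. exp (s * (F (x(i := y)) - G x)) \<partial>gauss)"
      by (intro nn_integral_eq_integral) auto
    also have "\<dots> \<le> ennreal (exp (s\<^sup>2 * l\<^sup>2))"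
      unfolding G_def by (intro ennreal_leI lipschitz_gauss_exp_le[OF lip1])
    finally show "(\<integral>\<^sup>+y. ennreal (exp (s * (F (x(i := y)) - G x))) \<partial>gauss) \<le> ennreal (exp (s\<^sup>2 * l\<^sup>2))" .
  qed auto
  also have "\<dots> = (\<integral>\<^sup>+x. ennreal (exp (s * (G x - ?m))) \<partial>gaussP I) * ennreal (exp (s\<^sup>2 * l\<^sup>2))"
    by (rule nn_integral_multc) (use G_meas in measurable)
  also have "\<dots> \<le> ennreal (exp (s\<^sup>2 * l\<^sup>2 * card I)) * ennreal (exp (s\<^sup>2 * l\<^sup>2))"
    by (intro mult_right_mono insert.IH G_meas G_lip) auto
  also have "\<dots> = ennreal (exp (s\<^sup>2 * l\<^sup>2 * card (insert i I)))"
    using insert.hyps by (simp add: ennreal_mult[symmetric] exp_add[symmetric] algebra_simps)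
  finally show ?case by (simp add: EF)
qed

lemma coord_lipschitz_gaussP_tail:
  fixes F :: "('i \<Rightarrow> real) \<Rightarrow> real"
  assumes I: "finite I" and meas: "F \<in> borel_measurable (gaussP I)"
    and lip: "\<And>x i y z. i \<in> I \<Longrightarrow> \<bar>F (x(i := y)) - F (x(i := z))\<bar> \<le> l * \<bar>y - z\<bar>"
    and s: "s \<ge> 0"
  defines "m \<equiv> \<integral>x. F x \<partial>gaussP I"
  shows "measure (gaussP I) {x \<in> space (gaussP I). a \<le> \<bar>F x - m\<bar>} \<le> 2 * exp (s\<^sup>2 * l\<^sup>2 * card I - s * a)"
proof -
  note [measurable] = meas
  \<comment> \<open>One Markov bound for both signs: the bound on the exponential moment depends on
    t only through its square.\<close>
  have *: "measure (gaussP I) {x \<in> space (gaussP I). s * a \<le> t * (F x - m)} \<le> exp (s\<^sup>2 * l\<^sup>2 * card I - s * a)"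
    if t: "t\<^sup>2 = s\<^sup>2" for t
  proof -
    have "emeasure (gaussP I) {x \<in> space (gaussP I). s * a \<le> t * (F x - m)} =
      emeasure (gaussP I) {x \<in> space (gaussP I). 1 \<le> ennreal (exp (- (s * a))) * ennreal (exp (t * (F x - m)))}"
      by (intro arg_cong[where f = "emeasure _"]) (auto simp: ennreal_mult[symmetric] exp_add[symmetric])
    also have "\<dots> \<le> ennreal (exp (- (s * a))) * (\<integral>\<^sup>+x. ennreal (exp (t * (F x - m))) * indicator (space (gaussP I)) x \<partial>gaussP I)"
      using nn_integral_Markov_inequality[where u = "\<lambda>x. ennreal (exp (t * (F x - m)))" and M = "gaussP I"
          and A = "space (gaussP I)" and c = "ennreal (exp (- (s * a)))"]
      by simp
    also have "(\<integral>\<^sup>+x. ennreal (exp (t * (F x - m))) * indicator (space (gaussP I)) x \<partial>gaussP I) =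
        (\<integral>\<^sup>+x. ennreal (exp (t * (F x - m))) \<partial>gaussP I)"
      by (intro nn_integral_cong) simp
    also have "ennreal (exp (- (s * a))) * \<dots> \<le> ennreal (exp (- (s * a))) * ennreal (exp (t\<^sup>2 * l\<^sup>2 * card I))"
      unfolding m_def by (intro mult_left_mono coord_lipschitz_gaussP_exp_le I meas lip) auto
    also have "\<dots> = ennreal (exp (s\<^sup>2 * l\<^sup>2 * card I - s * a))"
      by (simp add: t ennreal_mult[symmetric] exp_add[symmetric])
    finally show ?thesis
      by (simp add: gauss_prod.P.emeasure_eq_measure)
  qed
  have "{x \<in> space (gaussP I). a \<le> \<bar>F x - m\<bar>} \<subseteq>
    {x \<in> space (gaussP I). s * a \<le> s * (F x - m)} \<union> {x \<in> space (gaussP I). s * a \<le> (-s) * (F x - m)}"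
  proof safe
    fix x assume "a \<le> \<bar>F x - m\<bar>" "\<not> s * a \<le> (-s) * (F x - m)"
    then have "a \<le> F x - m \<or> a \<le> - (F x - m)" by linarith
    then have "s * a \<le> s * (F x - m) \<or> s * a \<le> s * (- (F x - m))"
      using s by (auto intro: mult_left_mono)
    then show "s * a \<le> s * (F x - m)" using \<open>\<not> s * a \<le> (-s) * (F x - m)\<close> by (auto simp: algebra_simps)
  qed
  then have "measure (gaussP I) {x \<in> space (gaussP I). a \<le> \<bar>F x - m\<bar>} \<le>
    measure (gaussP I) ({x \<in> space (gaussP I). s * a \<le> s * (F x - m)} \<union> {x \<in> space (gaussP I). s * a \<le> (-s) * (F x - m)})"
    by (intro gauss_prod.P.finite_measure_mono) auto
  also have "\<dots> \<le> measure (gaussP I) {x \<in> space (gaussP I). s * a \<le> s * (F x - m)}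
    + measure (gaussP I) {x \<in> space (gaussP I). s * a \<le> (-s) * (F x - m)}"
    by (intro measure_Un_le) auto
  also have "\<dots> \<le> 2 * exp (s\<^sup>2 * l\<^sup>2 * card I - s * a)"
    using *[of s] *[of "-s"] by simp
  finally show ?thesis .
qed

text \<open>The first Borel-Cantelli lemma asks only for summable tails and nothing of the joint law
  of the \<open>X n\<close>, which is just what a disorder with unspecified dependence across sizes
  offers.\<close>

lemma (in prob_space) AE_tendsto_of_exp_tail:
  fixes X :: "nat \<Rightarrow> 'a \<Rightarrow> real" and m :: "nat \<Rightarrow> real"
  assumes meas [measurable]: "\<And>n. X n \<in> borel_measurable M"
    and tail: "\<And>n \<epsilon>. n \<ge> 1 \<Longrightarrow> \<epsilon> > 0 \<Longrightarrow> prob {\<omega> \<in> space M. \<epsilon> \<le> \<bar>X n \<omega> - m n\<bar>} \<le> 2 * exp (- c \<epsilon> * n)"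
    and c: "\<And>\<epsilon>. \<epsilon> > 0 \<Longrightarrow> c \<epsilon> > 0"
    and m: "m \<longlonglongrightarrow> L"
  shows "AE \<omega> in M. (\<lambda>n. X n \<omega>) \<longlonglongrightarrow> L"
proof -
  have ev: "AE \<omega> in M. \<forall>\<^sub>F n in sequentially. \<bar>X n \<omega> - m n\<bar> < \<epsilon>" if \<epsilon>: "\<epsilon> > 0" for \<epsilon>
  proof -
    define A where "A = (\<lambda>n. {\<omega> \<in> space M. \<epsilon> \<le> \<bar>X n \<omega> - m n\<bar>})"
    have "summable (\<lambda>n. 2 * exp (- c \<epsilon>) ^ n)"
      using c[OF \<epsilon>] by (intro summable_mult summable_geometric) auto
    then have "summable (\<lambda>n. prob (A n))"
    proof (rule summable_comparison_test_ev[rotated], intro eventually_sequentiallyI[of 1])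
      fix n :: nat assume "1 \<le> n"
      then show "norm (prob (A n)) \<le> 2 * exp (- c \<epsilon>) ^ n"
        using tail[of n \<epsilon>] \<epsilon> by (simp add: A_def exp_of_nat_mult[symmetric] mult.commute)
    qed
    moreover have "A n \<in> events" for n unfolding A_def by measurable
    ultimately have "AE \<omega> in M. \<forall>\<^sub>F n in sequentially. \<omega> \<in> space M - A n"
      by (intro borel_cantelli_AE1) (auto simp: less_top[symmetric])
    then show ?thesis
      by eventually_elim (auto elim!: eventually_mono simp: A_def)
  qed
  have "AE \<omega> in M. \<forall>k::nat. \<forall>\<^sub>F n in sequentially. \<bar>X n \<omega> - m n\<bar> < 1 / Suc k"
    unfolding AE_all_countable by (intro allI ev) simp
  then show ?thesis
  proof eventually_elim
    case (elim \<omega>)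
    have "(\<lambda>n. X n \<omega> - m n) \<longlonglongrightarrow> 0"
    proof (rule tendstoI)
      fix e :: real assume "e > 0"
      then obtain k where "1 / real (Suc k) < e" using nat_approx_posE by blast
      then show "\<forall>\<^sub>F n in sequentially. dist (X n \<omega> - m n) 0 < e"
        using elim[rule_format, of k] by (auto elim!: eventually_mono)
    qed
    from tendsto_add[OF this m] show ?case by simp
  qed
qed

section \<open>The interpolation between the SK model and independent spins\<close>

definition overlap :: "nat \<Rightarrow> (nat \<Rightarrow> real) \<Rightarrow> (nat \<Rightarrow> real) \<Rightarrow> real" where
  "overlap N \<sigma> \<tau> = (\<Sum>i=1..N. \<sigma> i * \<tau> i) / real N"

lemma finite_sk_configs: "finite (sk_configs N)"
  unfolding sk_configs_def by (intro finite_PiE) auto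

lemma sk_configs_nonempty: "sk_configs N \<noteq> {}"
  unfolding sk_configs_def by (simp add: PiE_eq_empty_iff)

lemma sk_configs_sq: "\<sigma> \<in> sk_configs N \<Longrightarrow> i \<in> {1..N} \<Longrightarrow> \<sigma> i * \<sigma> i = 1"
  unfolding sk_configs_def by (auto dest!: PiE_mem)

lemma sk_configs_abs: "\<sigma> \<in> sk_configs N \<Longrightarrow> i \<in> {1..N} \<Longrightarrow> \<bar>\<sigma> i\<bar> = 1"
  unfolding sk_configs_def by (auto dest!: PiE_mem)

text \<open>The path is studied at a fixed size N with bounds explicit in N. The threshold 1 / 2
  enters through beta^2 <= 1 / 4 in \<open>guerra_lower\<close>.\<close>

locale sk_interpolation =
  fixes N :: nat and \<beta> h q :: real
  assumes N: "N \<ge> 1" and beta: "0 < \<beta>" "\<beta> \<le> 1 / 2" and q: "0 \<le> q"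
begin

definition sites :: "(nat \<times> nat) set" where
  "sites = {1..N} \<times> {0..N}"

text \<open>Index \<open>(i, 0)\<close> carries the Gaussian field at site \<open>i\<close> of the decoupled system, \<open>(i, j)\<close> with
  \<open>j \<ge> 1\<close> the coupling; \<open>t = 0\<close> is the decoupled and \<open>t = \<pi> / 2\<close> the original system.\<close>
definition coef :: "real \<Rightarrow> (nat \<Rightarrow> real) \<Rightarrow> nat \<times> nat \<Rightarrow> real" where
  "coef t \<sigma> k = (if snd k = 0 then cos t * (\<beta> * sqrt q * \<sigma> (fst k))
    else sin t * (\<beta> / sqrt (2 * real N) * \<sigma> (fst k) * \<sigma> (snd k)))"

definition coef' :: "real \<Rightarrow> (nat \<Rightarrow> real) \<Rightarrow> nat \<times> nat \<Rightarrow> real" where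
  "coef' t \<sigma> k = (if snd k = 0 then - sin t * (\<beta> * sqrt q * \<sigma> (fst k))
    else cos t * (\<beta> / sqrt (2 * real N) * \<sigma> (fst k) * \<sigma> (snd k)))"

definition energy :: "real \<Rightarrow> (nat \<times> nat \<Rightarrow> real) \<Rightarrow> (nat \<Rightarrow> real) \<Rightarrow> real" where
  "energy t x \<sigma> = h * (\<Sum>i=1..N. \<sigma> i) + (\<Sum>k\<in>sites. coef t \<sigma> k * x k)"

definition free_energy :: "real \<Rightarrow> real" where
  "free_energy t = (\<integral>x. ln (pf (sk_configs N) (energy t x)) \<partial>gaussP sites)"

definition overlap_fluct :: "real \<Rightarrow> (nat \<times> nat \<Rightarrow> real) \<Rightarrow> real" where
  "overlap_fluct t x = gibbs (sk_configs N) (energy t x) (\<lambda>\<sigma>. gibbs (sk_configs N) (energy t x)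
     (\<lambda>\<tau>. (overlap N \<sigma> \<tau> - q)\<^sup>2))"

text \<open>The coupling strength decreases along the path just fast enough to absorb the positive
  overlap term in the derivative of the coupled system.\<close>
definition coupling :: "real \<Rightarrow> real" where
  "coupling t = 1 / 4 - \<beta>\<^sup>2 / 2 * (sin t)\<^sup>2"

definition pair_coef :: "real \<Rightarrow> (nat \<Rightarrow> real) \<times> (nat \<Rightarrow> real) \<Rightarrow> nat \<times> nat \<Rightarrow> real" where
  "pair_coef t p k = coef t (fst p) k + coef t (snd p) k"

definition pair_field :: "real \<Rightarrow> (nat \<Rightarrow> real) \<times> (nat \<Rightarrow> real) \<Rightarrow> real" where
  "pair_field t p = h * (\<Sum>i=1..N. fst p i) + h * (\<Sum>i=1..N. snd p i)
     + coupling t * (N * (overlap N (fst p) (snd p) - q)\<^sup>2)"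

definition pair_energy :: "real \<Rightarrow> (nat \<times> nat \<Rightarrow> real) \<Rightarrow> (nat \<Rightarrow> real) \<times> (nat \<Rightarrow> real) \<Rightarrow> real" where
  "pair_energy t x p = pair_field t p + (\<Sum>k\<in>sites. pair_coef t p k * x k)"

definition coupled_free_energy :: "real \<Rightarrow> real" where
  "coupled_free_energy t = (\<integral>x. ln (pf (sk_configs N \<times> sk_configs N) (pair_energy t x)) \<partial>gaussP sites)"

lemma finite_sites: "finite sites"
  by (simp add: sites_def)

lemma sum_sites: "(\<Sum>k\<in>sites. f k) = (\<Sum>i=1..N. f (i, 0)) + (\<Sum>i=1..N. \<Sum>j=1..N. f (i, j))"
  for f :: "nat \<times> nat \<Rightarrow> real"
proof -
  have "(\<Sum>j=0..N. g j) = g 0 + (\<Sum>j=1..N. g j)" for g :: "nat \<Rightarrow> real"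
    by (simp add: sum.atLeast_Suc_atMost)
  then show ?thesis
    unfolding sites_def sum.cartesian_product[symmetric, of "\<lambda>i j. f (i, j)", simplified]
    by (simp add: sum.distrib)
qed

lemma pair_energy_eq:
  "pair_energy t x = (\<lambda>p. (case p of (\<sigma>, \<tau>) \<Rightarrow> energy t x \<sigma> + energy t x \<tau>)
     + coupling t * (N * (overlap N (fst p) (snd p) - q)\<^sup>2))"
  by (auto simp: fun_eq_iff pair_energy_def pair_field_def pair_coef_def energy_def sum.distrib distrib_right)

lemma coef_deriv: "((\<lambda>t. coef t \<sigma> k) has_real_derivative coef' t \<sigma> k) (at t)"
proof (cases "snd k = 0")
  case True
  then show ?thesis
    unfolding coef_def coef'_def by (simp only: if_True simp_thms) (intro DERIV_cmult_right DERIV_cos)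
next
  case False
  then show ?thesis
    unfolding coef_def coef'_def by (simp only: if_False) (intro DERIV_cmult_right DERIV_sin)
qed

lemma coef'_bound: 
  assumes "\<sigma> \<in> sk_configs N" "k \<in> sites"
  shows "\<bar>coef' t \<sigma> k\<bar> \<le> \<beta> * sqrt q + \<beta>"
proof -
  have s: "\<bar>\<sigma> (fst k)\<bar> = 1" "snd k \<noteq> 0 \<Longrightarrow> \<bar>\<sigma> (snd k)\<bar> = 1"
    using assms by (auto simp: sites_def intro!: sk_configs_abs)
  have 1: "\<beta> / sqrt (2 * real N) \<le> \<beta> / 1"
    using N beta by (intro divide_left_mono) auto
  have 2: "\<bar>sin t\<bar> * (\<beta> * sqrt q) \<le> 1 * (\<beta> * sqrt q)" 
    using beta q by (intro mult_right_mono) auto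
  have 3: "\<bar>cos t\<bar> * (\<beta> / sqrt (2 * real N)) \<le> 1 * (\<beta> / sqrt (2 * real N))" 
    using beta q by (intro mult_right_mono) auto
  have 4: "0 \<le> \<beta> * sqrt q" using beta q by simp
  show ?thesis
  proof (cases "snd k = 0")
    case True
    then have "\<bar>coef' t \<sigma> k\<bar> = \<bar>sin t\<bar> * (\<beta> * sqrt q)"
      using s beta q by (simp add: coef'_def abs_mult)
    then show ?thesis using 2 beta by linarith
  next
    case False
    then have "\<bar>coef' t \<sigma> k\<bar> = \<bar>cos t\<bar> * (\<beta> / sqrt (2 * real N))"
      using s beta q by (simp add: coef'_def abs_mult)
    then show ?thesis using 1 3 4 by linarith
  qed
qed

text \<open>Write R for the overlap. The couplings contribute R^2 and the random fields, whose
  weight decreases, contribute - 2 q R; completing the square produces the centring at q. The field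
  variance beta^2 q is chosen for this.\<close>

lemma covariance:
  "(\<Sum>k\<in>sites. coef' t \<sigma> k * coef t \<tau> k)
    = sin t * cos t * (\<beta>\<^sup>2 * N / 2) * ((overlap N \<sigma> \<tau> - q)\<^sup>2 - q\<^sup>2)"
proof -
  define A where "A = (\<Sum>i=1..N. \<sigma> i * \<tau> i)"
  have A: "A = N * overlap N \<sigma> \<tau>" using N by (simp add: A_def overlap_def)
  have sq: "sqrt q * sqrt q = q" "sqrt (2 * real N) * sqrt (2 * real N) = 2 * real N"
    using q by simp_all
  have "(\<Sum>i=1..N. coef' t \<sigma> (i, 0) * coef t \<tau> (i, 0)) = (\<Sum>i=1..N. - (sin t * cos t * \<beta>\<^sup>2 * q) * (\<sigma> i * \<tau> i))"
  proof (rule sum.cong[OF refl])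
    fix i
    have "coef' t \<sigma> (i, 0) * coef t \<tau> (i, 0) = - (sin t * cos t * \<beta>\<^sup>2 * (sqrt q * sqrt q)) * (\<sigma> i * \<tau> i)"
      by (simp add: coef_def coef'_def power2_eq_square del: real_sqrt_mult_self)
    then show "coef' t \<sigma> (i, 0) * coef t \<tau> (i, 0) = - (sin t * cos t * \<beta>\<^sup>2 * q) * (\<sigma> i * \<tau> i)"
      unfolding sq .
  qed
  also have "\<dots> = - (sin t * cos t * \<beta>\<^sup>2 * q) * A"
    unfolding A_def by (rule sum_distrib_left[symmetric])
  finally have 1: "(\<Sum>i=1..N. coef' t \<sigma> (i, 0) * coef t \<tau> (i, 0)) = - (sin t * cos t * \<beta>\<^sup>2 * q) * A" .
  have "(\<Sum>i=1..N. \<Sum>j=1..N. coef' t \<sigma> (i, j) * coef t \<tau> (i, j)) =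
      (\<Sum>i=1..N. \<Sum>j=1..N. sin t * cos t * \<beta>\<^sup>2 / (2 * real N) * ((\<sigma> i * \<tau> i) * (\<sigma> j * \<tau> j)))"
  proof (intro sum.cong refl)
    fix i j :: nat assume "j \<in> {1..N}"
    then have "coef' t \<sigma> (i, j) * coef t \<tau> (i, j) = sin t * cos t * \<beta>\<^sup>2 / (sqrt (2 * real N) * sqrt (2 * real N)) * ((\<sigma> i * \<tau> i) * (\<sigma> j * \<tau> j))"
      by (simp add: coef_def coef'_def power2_eq_square del: real_sqrt_mult_self)
    then show "coef' t \<sigma> (i, j) * coef t \<tau> (i, j) = sin t * cos t * \<beta>\<^sup>2 / (2 * real N) * ((\<sigma> i * \<tau> i) * (\<sigma> j * \<tau> j))"
      unfolding sq .
  qed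
  also have "\<dots> = sin t * cos t * \<beta>\<^sup>2 / (2 * real N) * (A * A)"
    unfolding A_def sum_product by (simp only: sum_distrib_left)
  finally have 2: "(\<Sum>i=1..N. \<Sum>j=1..N. coef' t \<sigma> (i, j) * coef t \<tau> (i, j)) = sin t * cos t * \<beta>\<^sup>2 / (2 * real N) * (A * A)" .
  show ?thesis
    unfolding sum_sites 1 2 A using N by (simp add: power2_eq_square field_simps)
qed

lemma overlap_self: "\<sigma> \<in> sk_configs N \<Longrightarrow> overlap N \<sigma> \<sigma> = 1"
  using N by (simp add: overlap_def sk_configs_sq)

lemma overlap_commute: "overlap N \<sigma> \<tau> = overlap N \<tau> \<sigma>"
  by (simp add: overlap_def mult.commute)

text \<open>As one Gibbs average over pairs, with an energy affine in x, the fluctuation falls under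
  \<open>integrable_gibbs\<close>.\<close>

lemma overlap_fluct_eq_pair: "overlap_fluct t x = gibbs (sk_configs N \<times> sk_configs N)
    (\<lambda>p. (h * (\<Sum>i=1..N. fst p i) + h * (\<Sum>i=1..N. snd p i)) + (\<Sum>k\<in>sites. pair_coef t p k * x k))
    (\<lambda>p. (overlap N (fst p) (snd p) - q)\<^sup>2)"
proof -
  have "(\<lambda>p. (h * (\<Sum>i=1..N. fst p i) + h * (\<Sum>i=1..N. snd p i)) + (\<Sum>k\<in>sites. pair_coef t p k * x k))
      = (\<lambda>(\<sigma>, \<tau>). energy t x \<sigma> + energy t x \<tau>)"
    by (auto simp: fun_eq_iff pair_coef_def energy_def sum.distrib distrib_right)
  then show ?thesis
    unfolding overlap_fluct_def gibbs_pair[symmetric] by (simp add: split_def)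
qed

lemma integrable_overlap_fluct: "integrable (gaussP sites) (overlap_fluct t)"
  unfolding overlap_fluct_eq_pair [abs_def]
  by (intro integrable_gibbs) (simp_all add: finite_sk_configs sk_configs_nonempty)

lemma overlap_fluct_nonneg: "overlap_fluct t x \<ge> 0"
  unfolding overlap_fluct_def by (intro gibbs_nonneg) auto

text \<open>On the diagonal the overlap is 1, which gives (1 - q)^2; the constant q^2 cancels
  between the one-replica and the two-replica term.\<close>

lemma free_energy_deriv:
  "(free_energy has_real_derivative
     sin t * cos t * (\<beta>\<^sup>2 * N / 2) * ((1 - q)\<^sup>2 - (\<integral>x. overlap_fluct t x \<partial>gaussP sites))) (at t)"
proof -
  let ?S = "sk_configs N" and ?a = "sin t * cos t * (\<beta>\<^sup>2 * N / 2)"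
  note S = finite_sk_configs sk_configs_nonempty
  have "(free_energy has_real_derivative (\<integral>x. gibbs ?S (energy t x) (\<lambda>\<sigma>. 0 + (\<Sum>k\<in>sites. coef' t \<sigma> k * coef t \<sigma> k))
      - gibbs ?S (energy t x) (\<lambda>\<sigma>. gibbs ?S (energy t x) (\<lambda>\<tau>. \<Sum>k\<in>sites. coef' t \<sigma> k * coef t \<tau> k)) \<partial>gaussP sites)) (at t)"
    unfolding free_energy_def [abs_def] energy_def [abs_def]
    by (rule gaussian_interpolation[OF S finite_sites, where A = "\<beta> * sqrt q + \<beta>"])
       (use coef_deriv coef'_bound beta q in auto)
  moreover have ptw: "gibbs ?S (energy t x) (\<lambda>\<sigma>. 0 + (\<Sum>k\<in>sites. coef' t \<sigma> k * coef t \<sigma> k))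
      - gibbs ?S (energy t x) (\<lambda>\<sigma>. gibbs ?S (energy t x) (\<lambda>\<tau>. \<Sum>k\<in>sites. coef' t \<sigma> k * coef t \<tau> k))
      = ?a * ((1 - q)\<^sup>2 - overlap_fluct t x)" for x
  proof -
    have "gibbs ?S (energy t x) (\<lambda>\<sigma>. 0 + (\<Sum>k\<in>sites. coef' t \<sigma> k * coef t \<sigma> k)) =
        gibbs ?S (energy t x) (\<lambda>\<sigma>. ?a * ((1 - q)\<^sup>2 - q\<^sup>2))"
      by (rule gibbs_cong) (simp add: covariance overlap_self)
    also have "\<dots> = ?a * ((1 - q)\<^sup>2 - q\<^sup>2)" by (rule gibbs_const[OF S])
    finally have 1: "gibbs ?S (energy t x) (\<lambda>\<sigma>. 0 + (\<Sum>k\<in>sites. coef' t \<sigma> k * coef t \<sigma> k)) = ?a * ((1 - q)\<^sup>2 - q\<^sup>2)" .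
    have 2: "gibbs ?S (energy t x) (\<lambda>\<sigma>. gibbs ?S (energy t x) (\<lambda>\<tau>. \<Sum>k\<in>sites. coef' t \<sigma> k * coef t \<tau> k)) = ?a * (overlap_fluct t x - q\<^sup>2)"
      unfolding covariance gibbs_cmult gibbs_diff gibbs_const[OF S] overlap_fluct_def ..
    show ?thesis unfolding 1 2 right_diff_distrib[symmetric] by simp
  qed
  moreover have eq: "(\<integral>x. ?a * ((1 - q)\<^sup>2 - overlap_fluct t x) \<partial>gaussP sites) = ?a * ((1 - q)\<^sup>2 - (\<integral>x. overlap_fluct t x \<partial>gaussP sites))"
    using integrable_overlap_fluct[of t] gauss_prod.P.prob_space[of sites] by simp
  ultimately show ?thesis by (simp only: ptw eq)
qed

lemma coupling_deriv: "(coupling has_real_derivative - \<beta>\<^sup>2 * (sin t * cos t)) (at t)"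
  unfolding coupling_def [abs_def] by (auto intro!: derivative_eq_intros)

text \<open>The diagonal of the pair kernel contains twice the squared deviation of the overlap
  within the pair; the decrease of the coupling cancels it exactly. Overlaps between different pairs
  enter with a negative sign and are dropped, leaving twice the replica symmetric rate.\<close>

lemma coupled_free_energy_deriv:
  assumes sc: "sin t * cos t \<ge> 0"
  shows "\<exists>D. (coupled_free_energy has_real_derivative D) (at t) \<and> D \<le> sin t * cos t * (\<beta>\<^sup>2 * N) * (1 - q)\<^sup>2"
proof -
  let ?S = "sk_configs N \<times> sk_configs N" and ?a = "sin t * cos t * (\<beta>\<^sup>2 * N / 2)"
  let ?D = "\<lambda>p. N * (overlap N (fst p) (snd p) - q)\<^sup>2"
  have S: "finite ?S" "?S \<noteq> {}" using finite_sk_configs sk_configs_nonempty by auto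
  define A where "A = (\<Sum>p\<in>?S. \<beta>\<^sup>2 * ?D p) + 2 * (\<beta> * sqrt q + \<beta>)"
  define \<Gamma> where "\<Gamma> = (\<lambda>p p'. \<Sum>k\<in>sites. (coef' t (fst p) k + coef' t (snd p) k) * pair_coef t p' k)"
  define V where "V = (\<lambda>x. gibbs ?S (pair_energy t x) (\<lambda>p. - \<beta>\<^sup>2 * (sin t * cos t) * ?D p + \<Gamma> p p)
      - gibbs ?S (pair_energy t x) (\<lambda>p. gibbs ?S (pair_energy t x) (\<Gamma> p)))"
  have "(coupled_free_energy has_real_derivative (\<integral>x. V x \<partial>gaussP sites)) (at t)"
    unfolding coupled_free_energy_def [abs_def] pair_energy_def [abs_def] V_def \<Gamma>_def
  proof (rule gaussian_interpolation[OF S finite_sites, where A = A])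
    fix t p
    show "((\<lambda>t. pair_field t p) has_real_derivative - \<beta>\<^sup>2 * (sin t * cos t) * ?D p) (at t)"
      unfolding pair_field_def by (auto intro!: derivative_eq_intros coupling_deriv)
    show "((\<lambda>t. pair_coef t p k) has_real_derivative coef' t (fst p) k + coef' t (snd p) k) (at t)" for k
      unfolding pair_coef_def by (intro DERIV_add coef_deriv)
    assume p: "p \<in> ?S"
    have "\<bar>sin t * cos t\<bar> * (\<beta>\<^sup>2 * ?D p) \<le> 1 * (\<beta>\<^sup>2 * ?D p)"
      unfolding abs_mult by (intro mult_right_mono mult_le_one) auto
    also have "\<dots> \<le> (\<Sum>p\<in>?S. \<beta>\<^sup>2 * ?D p)"
      using p S member_le_sum[of p ?S "\<lambda>p. \<beta>\<^sup>2 * ?D p"] by simp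
    finally have "\<bar>- \<beta>\<^sup>2 * (sin t * cos t) * ?D p\<bar> \<le> (\<Sum>p\<in>?S. \<beta>\<^sup>2 * ?D p)"
      by (simp add: abs_mult mult_ac)
    moreover have "0 \<le> 2 * (\<beta> * sqrt q + \<beta>)" using beta q by simp
    ultimately show "\<bar>- \<beta>\<^sup>2 * (sin t * cos t) * ?D p\<bar> \<le> A"
      unfolding A_def by linarith
    have "0 \<le> (\<Sum>p\<in>?S. \<beta>\<^sup>2 * ?D p)" by (intro sum_nonneg) auto
    then show "\<bar>coef' t (fst p) k + coef' t (snd p) k\<bar> \<le> A" if "k \<in> sites" for k
      using coef'_bound[of "fst p" k t] coef'_bound[of "snd p" k t] that p
      unfolding A_def by auto
  qed
  moreover have "V x \<le> sin t * cos t * (\<beta>\<^sup>2 * N) * (1 - q)\<^sup>2" for x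
  proof -
    have \<Gamma>: "\<Gamma> p p' = ?a * ((overlap N (fst p) (fst p') - q)\<^sup>2 + (overlap N (fst p) (snd p') - q)\<^sup>2
       + (overlap N (snd p) (fst p') - q)\<^sup>2 + (overlap N (snd p) (snd p') - q)\<^sup>2 - 4 * q\<^sup>2)" for p p'
    proof -
      have "\<Gamma> p p' = (\<Sum>k\<in>sites. coef' t (fst p) k * coef t (fst p') k) + (\<Sum>k\<in>sites. coef' t (fst p) k * coef t (snd p') k)
        + (\<Sum>k\<in>sites. coef' t (snd p) k * coef t (fst p') k) + (\<Sum>k\<in>sites. coef' t (snd p) k * coef t (snd p') k)"
        unfolding \<Gamma>_def pair_coef_def by (simp add: sum.distrib[symmetric] algebra_simps)
      moreover have "c * (u - r) + c * (v - r) + c * (w - r) + c * (z - r) = c * (u + v + w + z - 4 * r)"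
        for c u v w z r :: real
        by (simp add: algebra_simps)
      ultimately show ?thesis unfolding covariance by simp
    qed
    have a: "?a \<ge> 0" using sc by simp
    have "gibbs ?S (pair_energy t x) (\<lambda>p. - \<beta>\<^sup>2 * (sin t * cos t) * ?D p + \<Gamma> p p) =
        gibbs ?S (pair_energy t x) (\<lambda>p. ?a * (2 * (1 - q)\<^sup>2 - 4 * q\<^sup>2))"
    proof (rule gibbs_cong)
      fix p assume p: "p \<in> ?S"
      have o: "overlap N (fst p) (fst p) = 1" "overlap N (snd p) (snd p) = 1"
        "overlap N (snd p) (fst p) = overlap N (fst p) (snd p)"
        using p by (auto simp: overlap_self intro: overlap_commute)
      \<comment> \<open>The first term comes from the derivative of the coupling; d is the squared
        deviation of the overlap within the pair, u = (1 - q)^2 and r = q^2.\<close>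
      have "- b * s * (n * d) + s * (b * n / 2) * (u + d + d + u - 4 * r) = s * (b * n / 2) * (2 * u - 4 * r)"
        for b s n d u r :: real
        by (simp add: field_simps)
      then show "- \<beta>\<^sup>2 * (sin t * cos t) * ?D p + \<Gamma> p p = ?a * (2 * (1 - q)\<^sup>2 - 4 * q\<^sup>2)"
        unfolding \<Gamma> o by blast
    qed
    also have "\<dots> = ?a * (2 * (1 - q)\<^sup>2 - 4 * q\<^sup>2)" by (rule gibbs_const[OF S])
    finally have 1: "gibbs ?S (pair_energy t x) (\<lambda>p. - \<beta>\<^sup>2 * (sin t * cos t) * ?D p + \<Gamma> p p) =
       ?a * (2 * (1 - q)\<^sup>2 - 4 * q\<^sup>2)" .
    \<comment> \<open>The four squared deviations between two pairs are nonnegative, so only the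
      constant survives in the lower bound.\<close>
    have "?a * (- 4 * q\<^sup>2) \<le> \<Gamma> p p'" for p p'
      unfolding \<Gamma> by (intro mult_left_mono a) (simp add: add_nonneg_nonneg)
    then have "gibbs ?S (pair_energy t x) (\<lambda>p. ?a * (- 4 * q\<^sup>2)) \<le> gibbs ?S (pair_energy t x) (\<Gamma> p)" for p
      by (intro gibbs_mono S)
    then have "gibbs ?S (pair_energy t x) (\<lambda>p. ?a * (- 4 * q\<^sup>2)) \<le> gibbs ?S (pair_energy t x) (\<lambda>p. gibbs ?S (pair_energy t x) (\<Gamma> p))"
      by (intro gibbs_mono S) (simp only: gibbs_const[OF S])
    then show ?thesis
      unfolding V_def 1 gibbs_const[OF S] by (simp add: algebra_simps)
  qed
  then have "(\<integral>x. V x \<partial>gaussP sites) \<le> sin t * cos t * (\<beta>\<^sup>2 * N) * (1 - q)\<^sup>2"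
  proof -
    assume *: "V x \<le> sin t * cos t * (\<beta>\<^sup>2 * N) * (1 - q)\<^sup>2" for x
    have "(\<integral>x. V x \<partial>gaussP sites) \<le> (\<integral>x. sin t * cos t * (\<beta>\<^sup>2 * N) * (1 - q)\<^sup>2 \<partial>gaussP sites)"
    \<comment> \<open>This replaces a proof of integrability: in the other case the integral is 0 by
      convention, and the bound is nonnegative.\<close>
    proof (cases "integrable (gaussP sites) V")
      case True
      then show ?thesis using * by (intro integral_mono) auto
    next
      case False
      then have "(\<integral>x. V x \<partial>gaussP sites) = 0" by (rule not_integrable_integral_eq)
      then show ?thesis using sc gauss_prod.P.prob_space[of sites] by simp
    qed
    then show ?thesis using gauss_prod.P.prob_space[of sites] by simp
  qed
  ultimately show ?thesis by blast
qed

text \<open>Jensen for the product Gibbs measure of two uncoupled replicas: the coupled free energy,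
  convex in the coupling strength, lies above its tangent at strength 0, whose slope is N times the
  mean fluctuation.\<close>

lemma coupled_free_energy_ge: "coupled_free_energy t \<ge> 2 * free_energy t + coupling t * N * (\<integral>x. overlap_fluct t x \<partial>gaussP sites)"
proof -
  let ?S = "sk_configs N"
  note S1 = finite_sk_configs[of N] sk_configs_nonempty[of N]
  have S: "finite (?S \<times> ?S)" "?S \<times> ?S \<noteq> {}" using finite_sk_configs sk_configs_nonempty by auto
  have i1: "integrable (gaussP sites) (\<lambda>x. ln (pf ?S (energy t x)))"
    unfolding energy_def [abs_def] by (rule integrable_ln_pf[OF S1 finite_sites])
  have "2 * free_energy t + coupling t * N * (\<integral>x. overlap_fluct t x \<partial>gaussP sites) =
      (\<integral>x. 2 * ln (pf ?S (energy t x)) + coupling t * N * overlap_fluct t x \<partial>gaussP sites)"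
    unfolding free_energy_def using i1 integrable_overlap_fluct[of t] by simp
  also have "\<dots> \<le> coupled_free_energy t"
    unfolding coupled_free_energy_def
  proof (rule integral_mono)
    show "integrable (gaussP sites) (\<lambda>x. 2 * ln (pf ?S (energy t x)) + coupling t * N * overlap_fluct t x)"
      using i1 integrable_overlap_fluct[of t] by simp
    show "integrable (gaussP sites) (\<lambda>x. ln (pf (?S \<times> ?S) (pair_energy t x)))"
      unfolding pair_energy_def [abs_def] by (rule integrable_ln_pf[OF S finite_sites])
    fix x
    let ?H = "\<lambda>(\<sigma>, \<tau>). energy t x \<sigma> + energy t x \<tau>"
    let ?f = "\<lambda>p. coupling t * (N * (overlap N (fst p) (snd p) - q)\<^sup>2)"
    have fluct: "gibbs (?S \<times> ?S) ?H ?f = coupling t * N * overlap_fluct t x"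
      using gibbs_pair[of ?S "energy t x" "\<lambda>\<sigma> \<tau>. coupling t * (N * (overlap N \<sigma> \<tau> - q)\<^sup>2)"]
      by (simp add: split_def gibbs_cmult overlap_fluct_def)
    have "exp (coupling t * N * overlap_fluct t x) \<le> gibbs (?S \<times> ?S) ?H (\<lambda>p. exp (?f p))"
      using exp_gibbs_le[OF S, of ?H ?f] unfolding fluct .
    then have "(pf ?S (energy t x))\<^sup>2 * exp (coupling t * N * overlap_fluct t x) \<le> pf (?S \<times> ?S) (pair_energy t x)"
      unfolding pair_energy_eq pf_add[OF S] pf_pair by (intro mult_left_mono) auto
    then have "ln ((pf ?S (energy t x))\<^sup>2 * exp (coupling t * N * overlap_fluct t x)) \<le> ln (pf (?S \<times> ?S) (pair_energy t x))"
      using pf_pos[OF S1, of "energy t x"] by (intro ln_mono) auto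
    then show "2 * ln (pf ?S (energy t x)) + coupling t * N * overlap_fluct t x \<le> ln (pf (?S \<times> ?S) (pair_energy t x))"
      using pf_pos[OF S1, of "energy t x"] by (simp add: ln_mult ln_realpow)
  qed
  finally show ?thesis .
qed

section \<open>Bounds on the free energy at the end of the path\<close>

lemma sin_cos_nonneg: "0 \<le> t \<Longrightarrow> t \<le> pi / 2 \<Longrightarrow> sin t * cos t \<ge> 0"
  by (intro mult_nonneg_nonneg sin_ge_zero cos_ge_zero) auto

lemma sin_sq_deriv: "((\<lambda>t. c * (sin t)\<^sup>2) has_real_derivative 2 * c * (sin t * cos t)) (at t)"
  by (auto intro!: derivative_eq_intros)

lemma integral_overlap_fluct_nonneg: "(\<integral>x. overlap_fluct t x \<partial>gaussP sites) \<ge> 0"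
  by (intro integral_nonneg_AE AE_I2 overlap_fluct_nonneg)

text \<open>Once the replica symmetric term, which integrates to a multiple of (sin t)^2, is
  subtracted, the derivative is a nonpositive multiple of the mean fluctuation.\<close>

lemma guerra_upper: "free_energy (pi / 2) \<le> free_energy 0 + N * (\<beta>\<^sup>2 / 4 * (1 - q)\<^sup>2)"
proof -
  define G where "G = (\<lambda>t. free_energy t - (N * (\<beta>\<^sup>2 / 4 * (1 - q)\<^sup>2)) * (sin t)\<^sup>2)"
  have "G (pi / 2) \<le> G 0"
  proof (rule DERIV_nonpos_imp_nonincreasing[where f = G])
    fix t assume t: "0 \<le> t" "t \<le> pi / 2"
    have "(G has_real_derivative (sin t * cos t * (\<beta>\<^sup>2 * N / 2)) * - (\<integral>x. overlap_fluct t x \<partial>gaussP sites)) (at t)"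
      unfolding G_def
      by (rule DERIV_cong[OF DERIV_diff[OF free_energy_deriv sin_sq_deriv]]) (simp add: algebra_simps)
    moreover have "(sin t * cos t * (\<beta>\<^sup>2 * N / 2)) * - (\<integral>x. overlap_fluct t x \<partial>gaussP sites) \<le> 0"
      using sin_cos_nonneg[OF t] integral_overlap_fluct_nonneg by (intro mult_nonneg_nonpos) auto
    ultimately show "\<exists>y. (G has_real_derivative y) (at t) \<and> y \<le> 0" by blast
  qed simp
  then show ?thesis by (simp add: G_def)
qed

lemma coupled_free_energy_upper:
  assumes t: "0 \<le> t" "t \<le> pi / 2"
  shows "coupled_free_energy t \<le> coupled_free_energy 0 + N * (\<beta>\<^sup>2 / 2 * (1 - q)\<^sup>2) * (sin t)\<^sup>2"
proof -
  define G where "G = (\<lambda>t. coupled_free_energy t - (N * (\<beta>\<^sup>2 / 2 * (1 - q)\<^sup>2)) * (sin t)\<^sup>2)"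
  have "G t \<le> G 0"
  proof (rule DERIV_nonpos_imp_nonincreasing[OF t(1), where f = G])
    fix s assume s: "0 \<le> s" "s \<le> t"
    obtain D where D: "(coupled_free_energy has_real_derivative D) (at s)" "D \<le> sin s * cos s * (\<beta>\<^sup>2 * N) * (1 - q)\<^sup>2"
      using coupled_free_energy_deriv[of s] sin_cos_nonneg[of s] s t by auto
    have "(G has_real_derivative D - sin s * cos s * (\<beta>\<^sup>2 * N) * (1 - q)\<^sup>2) (at s)"
      unfolding G_def
      by (rule DERIV_cong[OF DERIV_diff[OF D(1) sin_sq_deriv]]) (simp add: algebra_simps)
    then show "\<exists>y. (G has_real_derivative y) (at s) \<and> y \<le> 0" using D(2) by (intro exI conjI) auto
  qed
  then show ?thesis by (simp add: G_def)
qed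

text \<open>Gronwall for the deficit \<open>D\<close>: its derivative is the overlap fluctuation, which the coupled
  system bounds by \<open>D\<close> itself up to a constant.\<close>
lemma guerra_lower:
  assumes L: "coupled_free_energy 0 - 2 * free_energy 0 \<le> L"
  shows "free_energy (pi / 2) \<ge> free_energy 0 + N * (\<beta>\<^sup>2 / 4 * (1 - q)\<^sup>2) - L * exp pi"
proof -
  define w where "w = (\<lambda>t. \<integral>x. overlap_fluct t x \<partial>gaussP sites)"
  define D where "D = (\<lambda>t. free_energy 0 + (N * (\<beta>\<^sup>2 / 4 * (1 - q)\<^sup>2)) * (sin t)\<^sup>2 - free_energy t)"
  have beta2: "\<beta>\<^sup>2 \<le> 1 / 4"
    using power_mono[OF beta(2), of 2] beta(1) by (simp add: power2_eq_square)
  have w0: "w t \<ge> 0" for t unfolding w_def by (rule integral_overlap_fluct_nonneg)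
  have bound: "N / 8 * w t \<le> 2 * D t + L" if t: "0 \<le> t" "t \<le> pi / 2" for t
  proof -
    have "\<beta>\<^sup>2 * (sin t)\<^sup>2 \<le> 1 / 4 * 1"
      using beta2 by (intro mult_mono) (auto simp: abs_square_le_1)
    \<comment> \<open>The coupling drops from 1 / 4 by at most beta^2 / 2 <= 1 / 8.\<close>
    then have "1 / 8 \<le> coupling t" unfolding coupling_def by simp
    then have "1 / 8 * (N * w t) \<le> coupling t * (N * w t)" using w0 by (intro mult_right_mono) auto
    also have "\<dots> \<le> coupled_free_energy t - 2 * free_energy t" using coupled_free_energy_ge[of t] by (simp add: w_def mult_ac)
    also have "\<dots> \<le> 2 * D t + L" using coupled_free_energy_upper[OF t] L unfolding D_def by (simp add: algebra_simps)
    finally show ?thesis by simp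
  qed
  \<comment> \<open>The factor exp (- 2 t) integrates the inequality (2 D + L)' <= 2 (2 D +
    L).\<close>
  define G where "G = (\<lambda>t. (2 * D t + L) * exp (- (2 * t)))"
  have "G (pi / 2) \<le> G 0"
  proof (rule DERIV_nonpos_imp_nonincreasing[where f = G])
    fix t assume t: "0 \<le> t" "t \<le> pi / 2"
    define d where "d = sin t * cos t * (\<beta>\<^sup>2 * N / 2) * w t"
    have dD: "(D has_real_derivative d) (at t)"
      unfolding D_def
      by (rule DERIV_cong[OF DERIV_diff[OF DERIV_add[OF DERIV_const sin_sq_deriv] free_energy_deriv]])
         (simp add: d_def w_def algebra_simps)
    have dG: "(G has_real_derivative (2 * d - 2 * (2 * D t + L)) * exp (- (2 * t))) (at t)"
      unfolding G_def by (auto intro!: derivative_eq_intros dD simp: algebra_simps)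
    \<comment> \<open>The factor of N w in D' is at most beta^2 / 2 <= 1 / 8, the constant in the
      lower bound for the coupling, so D' <= 2 D + L.\<close>
    have "sin t * cos t \<le> 1 * 1" using sin_cos_nonneg[OF t] t
      by (intro mult_mono) (auto intro: cos_ge_zero)
    then have "(sin t * cos t) * \<beta>\<^sup>2 \<le> 1 * (1 / 4)"
      using beta2 sin_cos_nonneg[OF t] by (intro mult_mono) auto
    then have "(sin t * cos t) * \<beta>\<^sup>2 * (N / 2 * w t) \<le> 1 / 4 * (N / 2 * w t)"
      using w0 by (intro mult_right_mono) auto
    then have "d \<le> N / 8 * w t" by (simp add: d_def mult_ac)
    also have "\<dots> \<le> 2 * D t + L" by (rule bound[OF t])
    finally have "(2 * d - 2 * (2 * D t + L)) * exp (- (2 * t)) \<le> 0"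
      by (intro mult_nonpos_nonneg) auto
    with dG show "\<exists>y. (G has_real_derivative y) (at t) \<and> y \<le> 0" by blast
  qed simp
  moreover have "G 0 = L" by (simp add: G_def D_def)
  ultimately have "(2 * D (pi / 2) + L) * exp (- pi) \<le> L" by (simp add: G_def)
  then have "(2 * D (pi / 2) + L) * exp (- pi) * exp pi \<le> L * exp pi" by (intro mult_right_mono) auto
  then have "2 * D (pi / 2) + L \<le> L * exp pi" by (simp add: mult.assoc exp_add[symmetric])
  \<comment> \<open>At t = 0 the deficit vanishes, so \<open>bound\<close> forces L to dominate a
    nonnegative fluctuation.\<close>
  moreover have "L \<ge> 0"
    using order_trans[OF mult_nonneg_nonneg[OF _ w0[of 0], of "N / 8"] bound[of 0]] by (simp add: D_def)
  moreover have "L * exp pi \<ge> 0" using \<open>L \<ge> 0\<close> by simp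
  ultimately have "D (pi / 2) \<le> L * exp pi" by linarith
  then show ?thesis by (simp add: D_def)
qed

end

section \<open>Two coupled replicas of independent spins\<close>

text \<open>Gibbs weight of one spin in the field \<open>v\<close>, that is \<open>exp (a * v) / (2 * cosh v)\<close> for \<open>a = 1\<close> or \<open>a = - 1\<close>.\<close>
definition spin_weight :: "real \<Rightarrow> real \<Rightarrow> real" where
  "spin_weight v a = (1 + a * tanh v) / 2"

lemma exp_eq_spin_weight: "a \<in> {-1, 1} \<Longrightarrow> exp (v * a) = 2 * cosh v * spin_weight v a"
proof -
  have c: "cosh v \<noteq> 0" by simp
  have "2 * cosh v * spin_weight v a = cosh v + a * sinh v"
    using c by (simp add: spin_weight_def tanh_def field_simps)
  moreover assume "a \<in> {-1, 1}"
  ultimately show ?thesis by (auto simp: cosh_def sinh_def field_simps)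
qed

lemma abs_tanh_less_1: "\<bar>tanh (v :: real)\<bar> < 1"
  using tanh_real_bounds[of v] by auto

lemma spin_weight_nonneg: "a \<in> {-1, 1} \<Longrightarrow> spin_weight v a \<ge> 0"
  using abs_tanh_less_1[of v] by (auto simp: spin_weight_def)

lemma spin_weight_le_1: "a \<in> {-1, 1} \<Longrightarrow> spin_weight v a \<le> 1"
  using abs_tanh_less_1[of v] by (auto simp: spin_weight_def)

text \<open>Hoeffding's lemma for the centred variable with values 1 - q and - 1 - q, hence on an
  interval of length 2.\<close>

lemma two_point_subgaussian:
  fixes q u :: real
  assumes "0 \<le> q" "q \<le> 1"
  shows "(1 + q) / 2 * exp (u * (1 - q)) + (1 - q) / 2 * exp (u * (- 1 - q)) \<le> exp (u\<^sup>2 / 2)"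
proof -
  have *: "p * exp (2 * s * (1 - p)) + (1 - p) * exp (- 2 * s * p) \<le> exp (s\<^sup>2 / 2)"
    if p: "0 \<le> p" "p \<le> 1" and s: "s \<ge> 0" for p s :: real
  proof -
    have pos: "1 + p * (exp (2 * s) - 1) > 0"
      using p s by (intro add_pos_nonneg mult_nonneg_nonneg) auto
    have "- (2 * s) * p + ln (1 + p * (exp (2 * s) - 1)) \<le> (2 * s)\<^sup>2 / 8"
      by (rule Hoeffdings_lemma_aux) (use p s in auto)
    then have "exp (- (2 * s) * p + ln (1 + p * (exp (2 * s) - 1))) \<le> exp (s\<^sup>2 / 2)"
      by (simp add: power_mult_distrib)
    moreover have "exp (- (2 * s) * p + ln (1 + p * (exp (2 * s) - 1))) = exp (- (2 * s * p)) * (1 + p * (exp (2 * s) - 1))"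
      unfolding exp_add using pos by simp
    moreover have "exp (- (2 * s * p)) * (1 + p * (exp (2 * s) - 1)) =
        p * exp (2 * s * (1 - p)) + (1 - p) * exp (- 2 * s * p)"
    proof -
      have "exp (2 * s * (1 - p)) = exp (2 * s) * exp (- (2 * s * p))"
        by (simp add: exp_add[symmetric] algebra_simps)
      then show ?thesis by (simp add: algebra_simps)
    qed
    ultimately show ?thesis by linarith
  qed
  show ?thesis
  proof (cases "u \<ge> 0")
    case True
    have e: "1 - (1 + q) / 2 = (1 - q) / 2" "2 * u * ((1 - q) / 2) = u * (1 - q)" "- 2 * u * ((1 + q) / 2) = u * (- 1 - q)"
      by (simp_all add: field_simps)
    show ?thesis using *[of "(1 + q) / 2" u] assms True unfolding e by simp
  next
    case False
    \<comment> \<open>The bound above is for nonnegative s, so for negative u the two atoms exchange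
      roles.\<close>
    have e: "1 - (1 - q) / 2 = (1 + q) / 2" "2 * (- u) * ((1 + q) / 2) = u * (- 1 - q)" "- 2 * (- u) * ((1 - q) / 2) = u * (1 - q)"
      by (simp_all add: field_simps)
    show ?thesis using *[of "(1 - q) / 2" "- u"] assms False unfolding e by simp
  qed
qed

text \<open>The integrand becomes sqrt 2 times the density of variance 2. The value is 1 / sqrt (1 -
  2 c) for c = 1 / 4, the initial coupling strength.\<close>

lemma gauss_exp_sq: 
  "integrable gauss (\<lambda>y. exp (y\<^sup>2 / 4))" "(\<integral>y. exp (y\<^sup>2 / 4) \<partial>gauss) = sqrt 2"
proof -
  have eq: "std_normal_density y * exp (y\<^sup>2 / 4) = sqrt 2 * normal_density 0 (sqrt 2) y" for y
  proof -
    have "exp (- y\<^sup>2 / 2) * exp (y\<^sup>2 / 4) = exp (- y\<^sup>2 / 4)"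
      by (simp add: exp_add[symmetric])
    then show ?thesis
      by (simp add: normal_density_def real_sqrt_mult) (simp add: field_simps)
  qed
  show "integrable gauss (\<lambda>y. exp (y\<^sup>2 / 4))"
    by (subst gauss_integrable_iff) (auto simp: eq integrable_normal_density)
  show "(\<integral>y. exp (y\<^sup>2 / 4) \<partial>gauss) = sqrt 2"
    by (subst gauss_integral) (auto simp: eq integral_normal_density)
qed

lemma measurable_tanh_linear [measurable]: "(\<lambda>x. tanh (a + b * x :: real)) \<in> borel_measurable borel"
  by (intro borel_measurable_continuous_onI continuous_intros) auto

lemma ln_cosh_bounds: "0 \<le> ln (cosh x)" "ln (cosh x) \<le> \<bar>x\<bar>" for x :: real
proof -
  show "0 \<le> ln (cosh x)" using cosh_real_ge_1[of x] by simp
  have "cosh x \<le> exp \<bar>x\<bar>" by (cases "x \<ge> 0") (auto simp: cosh_def)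
  then have "ln (cosh x) \<le> ln (exp \<bar>x\<bar>)" using cosh_real_pos[of x] by (intro ln_mono) auto
  then show "ln (cosh x) \<le> \<bar>x\<bar>" by simp
qed

lemma integrable_ln_cosh: "integrable gauss (\<lambda>x. ln (cosh (a + b * x)))"
proof (rule Bochner_Integration.integrable_bound)
  show "integrable gauss (\<lambda>x. \<bar>a\<bar> + \<bar>b\<bar> * \<bar>x\<bar>)" using gauss_integrable_abs by simp
  have "(\<lambda>x. ln (cosh (a + b * x))) \<in> borel_measurable borel"
    using cosh_real_pos by (intro borel_measurable_continuous_onI continuous_intros) (auto simp: less_imp_neq[symmetric])
  then show "(\<lambda>x. ln (cosh (a + b * x))) \<in> borel_measurable gauss" by simp
  have "\<bar>ln (cosh (a + b * x))\<bar> \<le> \<bar>a\<bar> + \<bar>b\<bar> * \<bar>x\<bar>" for x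
    using ln_cosh_bounds[of "a + b * x"] abs_triangle_ineq[of a "b * x"] by (simp add: abs_mult)
  then show "AE x in gauss. norm (ln (cosh (a + b * x))) \<le> norm (\<bar>a\<bar> + \<bar>b\<bar> * \<bar>x\<bar>)"
    unfolding real_norm_def by (intro AE_I2) (rule order_trans[OF _ abs_ge_self])
qed

text \<open>The mean product of two independent spins in a common Gaussian field; equality with q is
  the stationarity condition of the functional in \<open>RS\<close>.\<close>

definition field_mean :: "real \<Rightarrow> real \<Rightarrow> real \<Rightarrow> real" where
  "field_mean \<beta> h q = (\<integral>x. (tanh (h + \<beta> * sqrt q * x))\<^sup>2 \<partial>gauss)"

section \<open>The decoupled system at t = 0\<close>

context sk_interpolation
begin

lemma energy_0: "energy 0 x \<sigma> = (\<Sum>i=1..N. (h + \<beta> * sqrt q * x (i, 0)) * \<sigma> i)"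
  unfolding energy_def sum_sites
  by (simp add: coef_def sum_distrib_left sum.distrib[symmetric] algebra_simps)

lemma pf_0: "pf (sk_configs N) (energy 0 x) = (\<Prod>i=1..N. 2 * cosh (h + \<beta> * sqrt q * x (i, 0)))"
proof -
  have "pf (sk_configs N) (energy 0 x) =
      (\<Sum>\<sigma>\<in>sk_configs N. \<Prod>i=1..N. exp ((h + \<beta> * sqrt q * x (i, 0)) * \<sigma> i))"
    unfolding pf_def energy_0 by (simp add: exp_sum)
  also have "\<dots> = (\<Prod>i=1..N. \<Sum>a\<in>{-1, 1}. exp ((h + \<beta> * sqrt q * x (i, 0)) * a))"
    unfolding sk_configs_def by (rule prod_sum_PiE[symmetric]) auto
  also have "\<dots> = (\<Prod>i=1..N. 2 * cosh (h + \<beta> * sqrt q * x (i, 0)))"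
    by (intro prod.cong refl) (simp add: cosh_def)
  finally show ?thesis .
qed

lemma free_energy_0: "free_energy 0 = N * ln 2 + N * (\<integral>x. ln (cosh (h + \<beta> * sqrt q * x)) \<partial>gauss)"
proof -
  let ?f = "\<lambda>x. ln (cosh (h + \<beta> * sqrt q * x))"
  have ln_pf: "ln (pf (sk_configs N) (energy 0 x)) = N * ln 2 + (\<Sum>i=1..N. ?f (x (i, 0)))" for x
    unfolding pf_0 by (subst ln_prod) (simp_all add: ln_mult sum.distrib)
  have f: "?f \<in> borel_measurable borel"
    using borel_measurable_integrable[OF integrable_ln_cosh, of h "\<beta> * sqrt q"] by simp
  have int: "integrable (gaussP sites) (\<lambda>x. ?f (x (i, 0)))"
    and eq: "(\<integral>x. ?f (x (i, 0)) \<partial>gaussP sites) = (\<integral>x. ?f x \<partial>gauss)" if "i \<in> {1..N}" for i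
  proof -
    have "(i, 0) \<in> sites" using that by (auto simp: sites_def)
    then show "integrable (gaussP sites) (\<lambda>x. ?f (x (i, 0)))"
      "(\<integral>x. ?f (x (i, 0)) \<partial>gaussP sites) = (\<integral>x. ?f x \<partial>gauss)"
      using gaussP_coord[of "(i, 0)" sites ?f] f integrable_ln_cosh by auto
  qed
  have "free_energy 0 = (\<integral>x. N * ln 2 \<partial>gaussP sites) + (\<integral>x. (\<Sum>i=1..N. ?f (x (i, 0))) \<partial>gaussP sites)"
    unfolding free_energy_def ln_pf
    by (intro Bochner_Integration.integral_add Bochner_Integration.integrable_sum int) simp_all
  also have "(\<integral>x. (\<Sum>i=1..N. ?f (x (i, 0))) \<partial>gaussP sites) = (\<Sum>i=1..N. \<integral>x. ?f (x (i, 0)) \<partial>gaussP sites)"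
    by (intro Bochner_Integration.integral_sum int)
  also have "\<dots> = N * (\<integral>x. ?f x \<partial>gauss)"
    by (simp add: eq del: One_nat_def)
  finally show ?thesis using gauss_prod.P.prob_space[of sites] by simp
qed

text \<open>Probability that two replicas take the values a and b at a given site, after averaging
  over the field.\<close>

definition pair_weight :: "real \<Rightarrow> real \<Rightarrow> real" where
  "pair_weight a b = (\<integral>x. spin_weight (h + \<beta> * sqrt q * x) a * spin_weight (h + \<beta> * sqrt q * x) b \<partial>gauss)"

text \<open>The term linear in tanh cancels in both sums and the square integrates to q. The product
  of the two spins thus has mean q.\<close>

lemma pair_weight_eq:
  assumes "field_mean \<beta> h q = q"
  shows "pair_weight 1 1 + pair_weight (-1) (-1) = (1 + q) / 2"
    "pair_weight 1 (-1) + pair_weight (-1) 1 = (1 - q) / 2"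
proof -
  let ?t = "\<lambda>x. tanh (h + \<beta> * sqrt q * x)"
  have "\<bar>?t x\<bar> \<le> 1" for x using abs_tanh_less_1[of "h + \<beta> * sqrt q * x"] by simp
  then have 1: "integrable gauss ?t" by (intro gauss.integrable_const_bound[where B = 1] AE_I2) auto
  have "\<bar>(?t x)\<^sup>2\<bar> \<le> 1" for x using abs_tanh_less_1[of "h + \<beta> * sqrt q * x"]
    by (simp add: abs_square_le_1)
  then have 2: "integrable gauss (\<lambda>x. (?t x)\<^sup>2)"
    by (intro gauss.integrable_const_bound[where B = 1] AE_I2) auto
  have "pair_weight a b = (\<integral>x. 1 / 4 + (a + b) / 4 * ?t x + a * b / 4 * (?t x)\<^sup>2 \<partial>gauss)" for a b
    unfolding pair_weight_def spin_weight_def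
    by (intro Bochner_Integration.integral_cong) (auto simp: power2_eq_square field_simps)
  also have "\<dots> a b = 1 / 4 + (a + b) / 4 * (\<integral>x. ?t x \<partial>gauss) + a * b / 4 * q" for a b
    using 1 2 assms by (simp add: field_mean_def)
  finally have "pair_weight a b = 1 / 4 + (a + b) / 4 * (\<integral>x. ?t x \<partial>gauss) + a * b / 4 * q" for a b .
  note pw = this
  show "pair_weight 1 1 + pair_weight (-1) (-1) = (1 + q) / 2"
    "pair_weight 1 (-1) + pair_weight (-1) 1 = (1 - q) / 2" unfolding pw by (simp_all add: field_simps)
qed

text \<open>Fields at different sites are independent. A constant factor 1 at the coupling indices
  turns the product into one over all of \<open>sites\<close>, to which the product formula for
  integrals applies.\<close>

lemma spin_weight_prod_integral:
  assumes "\<sigma> \<in> sk_configs N" "\<tau> \<in> sk_configs N"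
  shows "integrable (gaussP sites) (\<lambda>x. \<Prod>i=1..N. spin_weight (h + \<beta> * sqrt q * x (i, 0)) (\<sigma> i)
      * spin_weight (h + \<beta> * sqrt q * x (i, 0)) (\<tau> i))" (is "integrable _ ?f")
    and "(\<integral>x. (\<Prod>i=1..N. spin_weight (h + \<beta> * sqrt q * x (i, 0)) (\<sigma> i)
      * spin_weight (h + \<beta> * sqrt q * x (i, 0)) (\<tau> i)) \<partial>gaussP sites) = (\<Prod>i=1..N. pair_weight (\<sigma> i) (\<tau> i))"
proof -
  define g where "g = (\<lambda>k :: nat \<times> nat. \<lambda>y. if snd k = 0 then spin_weight (h + \<beta> * sqrt q * y) (\<sigma> (fst k))
      * spin_weight (h + \<beta> * sqrt q * y) (\<tau> (fst k)) else 1)"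
  have P: "(\<Prod>k\<in>sites. G (fst k) (snd k)) = (\<Prod>i=1..N. G i 0)" if "\<And>i j. j \<noteq> 0 \<Longrightarrow> G i j = 1" for G :: "nat \<Rightarrow> nat \<Rightarrow> real"
  proof -
    have "(\<Prod>k\<in>sites. G (fst k) (snd k)) = (\<Prod>i=1..N. \<Prod>j=0..N. G i j)"
      unfolding sites_def prod.cartesian_product by (simp add: split_def)
    moreover have "(\<Prod>j=0..N. G i j) = G i 0" for i
      by (subst prod.atLeast_Suc_atMost) (auto intro!: prod.neutral that)
    ultimately show ?thesis by simp
  qed
  have f: "?f = (\<lambda>x. \<Prod>k\<in>sites. g k (x k))"
    using P[of "\<lambda>i j. g (i, j) (x (i, j))" for x] by (auto simp: g_def fun_eq_iff)
  have s: "\<sigma> i \<in> {-1, 1}" "\<tau> i \<in> {-1, 1}" if "i \<in> {1..N}" for i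
    using assms that unfolding sk_configs_def by (auto dest!: PiE_mem)
  have int: "integrable gauss (g k)" if k: "k \<in> sites" for k
  proof (rule gauss.integrable_const_bound[where B = 1])
    show "g k \<in> borel_measurable gauss" unfolding g_def spin_weight_def by simp
    have i: "fst k \<in> {1..N}" using k by (auto simp: sites_def)
    have "\<bar>g k y\<bar> \<le> 1" for y
      using spin_weight_le_1[OF s(1)[OF i], of "h + \<beta> * sqrt q * y"] spin_weight_le_1[OF s(2)[OF i], of "h + \<beta> * sqrt q * y"]
        spin_weight_nonneg[OF s(1)[OF i], of "h + \<beta> * sqrt q * y"] spin_weight_nonneg[OF s(2)[OF i], of "h + \<beta> * sqrt q * y"]
      by (auto simp: g_def abs_mult intro!: mult_le_one)
    then show "AE y in gauss. norm (g k y) \<le> 1" by simp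
  qed
  show "integrable (gaussP sites) ?f"
    unfolding f by (intro gauss_prod.product_integrable_prod finite_sites int)
  have "(\<integral>x. ?f x \<partial>gaussP sites) = (\<Prod>k\<in>sites. \<integral>y. g k y \<partial>gauss)"
    unfolding f by (intro gauss_prod.product_integral_prod finite_sites int)
  also have "\<dots> = (\<Prod>i=1..N. pair_weight (\<sigma> i) (\<tau> i))"
    using P[of "\<lambda>i j. \<integral>y. g (i, j) y \<partial>gauss"] by (simp add: g_def pair_weight_def)
  finally show "(\<integral>x. ?f x \<partial>gaussP sites) = (\<Prod>i=1..N. pair_weight (\<sigma> i) (\<tau> i))" .
qed

text \<open>Under the averaged decoupled measure the products of the two replicas are independent with
  mean \<open>q\<close>; the square in the exponent is linearised by an auxiliary Gaussian \<open>y\<close>.\<close>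
lemma overlap_exp_moment:
  assumes fix_point: "field_mean \<beta> h q = q"
  shows "(\<Sum>\<sigma>\<in>sk_configs N. \<Sum>\<tau>\<in>sk_configs N. (\<Prod>i=1..N. pair_weight (\<sigma> i) (\<tau> i))
      * exp (N / 4 * (overlap N \<sigma> \<tau> - q)\<^sup>2)) \<le> sqrt 2"
proof -
  \<comment> \<open>Read off from the nonnegative probability of disagreement.\<close>
  have q1: "q \<le> 1"
  proof -
    have "pair_weight 1 (-1) \<ge> 0" "pair_weight (-1) 1 \<ge> 0"
      unfolding pair_weight_def by (auto intro!: integral_nonneg_AE AE_I2 mult_nonneg_nonneg spin_weight_nonneg)
    then show ?thesis using pair_weight_eq(2)[OF fix_point] by simp
  qed
  \<comment> \<open>Scaled so that u times the centred sum over the sites is y sqrt (N / 2) (R - q),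
    with R the overlap; averaging over y then yields exp (N / 4 (R - q)^2).\<close>
  define u where "u = (\<lambda>y. y / sqrt (2 * N))"
  let ?P = "\<lambda>\<sigma> \<tau>. \<Prod>i=1..N. pair_weight (\<sigma> i) (\<tau> i)"
  have lin: "u y * (\<Sum>i=1..N. \<sigma> i * \<tau> i - q) = sqrt (N / 2) * (overlap N \<sigma> \<tau> - q) * y" for y \<sigma> \<tau>
  proof -
    have "(\<Sum>i=1..N. \<sigma> i * \<tau> i - q) = N * (overlap N \<sigma> \<tau> - q)"
      using N by (simp add: overlap_def sum_subtractf algebra_simps)
    moreover have "sqrt (N / 2) * sqrt (2 * N) = N"
      by (simp add: real_sqrt_mult[symmetric])
    then have "N / sqrt (2 * N) = sqrt (N / 2)"
      using N by (simp add: nonzero_divide_eq_eq)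
    moreover have "u y * (N * (overlap N \<sigma> \<tau> - q)) = N / sqrt (2 * N) * (overlap N \<sigma> \<tau> - q) * y"
      by (simp add: u_def)
    ultimately show ?thesis by (simp only:)
  qed
  have E: "(\<integral>y. exp (u y * (\<Sum>i=1..N. \<sigma> i * \<tau> i - q)) \<partial>gauss) = exp (N / 4 * (overlap N \<sigma> \<tau> - q)\<^sup>2)"
    and I: "integrable gauss (\<lambda>y. exp (u y * (\<Sum>i=1..N. \<sigma> i * \<tau> i - q)))" for \<sigma> \<tau>
    unfolding lin using gauss_exp[of "sqrt (N / 2) * (overlap N \<sigma> \<tau> - q)"]
    by (simp_all add: power_mult_distrib)
  have "(\<Sum>\<sigma>\<in>sk_configs N. \<Sum>\<tau>\<in>sk_configs N. ?P \<sigma> \<tau> * exp (N / 4 * (overlap N \<sigma> \<tau> - q)\<^sup>2)) =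
      (\<integral>y. (\<Sum>\<sigma>\<in>sk_configs N. \<Sum>\<tau>\<in>sk_configs N. ?P \<sigma> \<tau> * exp (u y * (\<Sum>i=1..N. \<sigma> i * \<tau> i - q))) \<partial>gauss)"
    using I by (simp add: E del: One_nat_def)
  also have "\<dots> \<le> (\<integral>y. exp (y\<^sup>2 / 4) \<partial>gauss)"
  proof (rule integral_mono)
    show "integrable gauss (\<lambda>y. exp (y\<^sup>2 / 4))" by (rule gauss_exp_sq)
    show "integrable gauss (\<lambda>y. \<Sum>\<sigma>\<in>sk_configs N. \<Sum>\<tau>\<in>sk_configs N. ?P \<sigma> \<tau> * exp (u y * (\<Sum>i=1..N. \<sigma> i * \<tau> i - q)))"
      using I by simp
    fix y
    define r where "r = (\<lambda>a b. pair_weight a b * exp (u y * (a * b - q)))"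
    have "(\<Sum>\<sigma>\<in>sk_configs N. \<Sum>\<tau>\<in>sk_configs N. ?P \<sigma> \<tau> * exp (u y * (\<Sum>i=1..N. \<sigma> i * \<tau> i - q))) =
        (\<Sum>\<sigma>\<in>sk_configs N. \<Sum>\<tau>\<in>sk_configs N. \<Prod>i=1..N. r (\<sigma> i) (\<tau> i))"
      unfolding r_def sum_distrib_left by (simp add: exp_sum prod.distrib)
    also have "\<dots> = (\<Sum>\<sigma>\<in>sk_configs N. \<Prod>i=1..N. \<Sum>b\<in>{-1, 1}. r (\<sigma> i) b)"
      unfolding sk_configs_def by (intro sum.cong refl prod_sum_PiE[symmetric]) auto
    also have "\<dots> = (\<Prod>i=1..N. \<Sum>a\<in>{-1, 1}. \<Sum>b\<in>{-1, 1}. r a b)"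
      unfolding sk_configs_def by (rule prod_sum_PiE[symmetric]) auto
    also have "\<dots> = (\<Sum>a\<in>{-1, 1}. \<Sum>b\<in>{-1, 1}. r a b) ^ N" by simp
    also have "(\<Sum>a\<in>{-1, 1}. \<Sum>b\<in>{-1, 1}. r a b) =
      (pair_weight 1 1 + pair_weight (-1) (-1)) * exp (u y * (1 - q))
      + (pair_weight 1 (-1) + pair_weight (-1) 1) * exp (u y * (- 1 - q))"
      by (simp add: r_def distrib_right)
    also have "\<dots> = (1 + q) / 2 * exp (u y * (1 - q)) + (1 - q) / 2 * exp (u y * (- 1 - q))"
      unfolding pair_weight_eq[OF fix_point] ..
    \<comment> \<open>The N sites together give exp (N u^2 / 2) = exp (y^2 / 4).\<close>
    also have "\<dots> ^ N \<le> exp ((u y)\<^sup>2 / 2) ^ N"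
      by (intro power_mono two_point_subgaussian q q1 add_nonneg_nonneg mult_nonneg_nonneg) (use q q1 in auto)
    also have "\<dots> = exp (y\<^sup>2 / 4)"
      using N by (simp add: exp_of_nat_mult[symmetric] u_def power_divide)
    finally show "(\<Sum>\<sigma>\<in>sk_configs N. \<Sum>\<tau>\<in>sk_configs N. ?P \<sigma> \<tau> * exp (u y * (\<Sum>i=1..N. \<sigma> i * \<tau> i - q))) \<le> exp (y\<^sup>2 / 4)" .
  qed
  also have "\<dots> = sqrt 2" by (rule gauss_exp_sq)
  finally show ?thesis .
qed

text \<open>The difference is the mean of ln X, with X the Gibbs average of the exponential coupling
  in a given field. Jensen moves the mean inside, where the sites become independent and
  \<open>overlap_exp_moment\<close> applies.\<close>

lemma coupled_free_energy_0_le: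
  assumes fix_point: "field_mean \<beta> h q = q"
  shows "coupled_free_energy 0 - 2 * free_energy 0 \<le> ln (sqrt 2)"
proof -
  let ?S = "sk_configs N"
  let ?H = "\<lambda>x. \<lambda>(\<sigma>, \<tau>). energy 0 x \<sigma> + energy 0 x \<tau>"
  let ?w = "\<lambda>x \<sigma> \<tau>. \<Prod>i=1..N. spin_weight (h + \<beta> * sqrt q * x (i, 0)) (\<sigma> i)
      * spin_weight (h + \<beta> * sqrt q * x (i, 0)) (\<tau> i)"
  let ?e = "\<lambda>\<sigma> \<tau>. exp (N / 4 * (overlap N \<sigma> \<tau> - q)\<^sup>2)"
  note S1 = finite_sk_configs[of N] sk_configs_nonempty[of N]
  have S: "finite (?S \<times> ?S)" "?S \<times> ?S \<noteq> {}" using finite_sk_configs sk_configs_nonempty by auto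
  define X where "X = (\<lambda>x. gibbs (?S \<times> ?S) (?H x) (\<lambda>(\<sigma>, \<tau>). ?e \<sigma> \<tau>))"
  have exp_energy: "exp (energy 0 x \<sigma>) = pf ?S (energy 0 x) * (\<Prod>i=1..N. spin_weight (h + \<beta> * sqrt q * x (i, 0)) (\<sigma> i))"
    if "\<sigma> \<in> ?S" for x \<sigma>
  proof -
    have "\<sigma> i \<in> {-1, 1}" if "i \<in> {1..N}" for i
      using \<open>\<sigma> \<in> ?S\<close> that unfolding sk_configs_def by (auto dest!: PiE_mem)
    then show ?thesis
      unfolding energy_0 pf_0 prod.distrib[symmetric]
      by (simp only: exp_sum finite_atLeastAtMost) (intro prod.cong refl exp_eq_spin_weight)
  qed
  have X: "X x = (\<Sum>\<sigma>\<in>?S. \<Sum>\<tau>\<in>?S. ?w x \<sigma> \<tau> * ?e \<sigma> \<tau>)" for x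
  proof -
    have "(\<Sum>p\<in>?S \<times> ?S. exp (?H x p) * (case p of (\<sigma>, \<tau>) \<Rightarrow> ?e \<sigma> \<tau>)) =
      (\<Sum>\<sigma>\<in>?S. \<Sum>\<tau>\<in>?S. (pf ?S (energy 0 x))\<^sup>2 * (?w x \<sigma> \<tau> * ?e \<sigma> \<tau>))"
      unfolding sum.cartesian_product
      by (intro sum.cong refl) (auto simp: exp_add exp_energy power2_eq_square prod.distrib)
    also have "\<dots> = (pf ?S (energy 0 x))\<^sup>2 * (\<Sum>\<sigma>\<in>?S. \<Sum>\<tau>\<in>?S. ?w x \<sigma> \<tau> * ?e \<sigma> \<tau>)"
      by (simp only: sum_distrib_left)
    finally show ?thesis
      unfolding X_def gibbs_def pf_pair using pf_pos[OF S1, of "energy 0 x"] by simp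
  qed
  have i: "integrable (gaussP sites) (\<lambda>x. ?w x \<sigma> \<tau>)" if "\<sigma> \<in> ?S" "\<tau> \<in> ?S" for \<sigma> \<tau>
    by (rule spin_weight_prod_integral(1)[OF that])
  have X_int: "integrable (gaussP sites) X"
    unfolding X [abs_def] by (intro Bochner_Integration.integrable_sum integrable_mult_left i)
  have "(\<integral>x. X x \<partial>gaussP sites) = (\<Sum>\<sigma>\<in>?S. \<Sum>\<tau>\<in>?S. (\<Prod>i=1..N. pair_weight (\<sigma> i) (\<tau> i)) * ?e \<sigma> \<tau>)"
  proof -
    have "(\<integral>x. X x \<partial>gaussP sites) = (\<Sum>\<sigma>\<in>?S. \<Sum>\<tau>\<in>?S. (\<integral>x. ?w x \<sigma> \<tau> * ?e \<sigma> \<tau> \<partial>gaussP sites))"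
      unfolding X by (subst Bochner_Integration.integral_sum, intro Bochner_Integration.integrable_sum integrable_mult_left i, assumption+)
        (intro sum.cong refl Bochner_Integration.integral_sum integrable_mult_left i)
    also have "\<dots> = (\<Sum>\<sigma>\<in>?S. \<Sum>\<tau>\<in>?S. (\<Prod>i=1..N. pair_weight (\<sigma> i) (\<tau> i)) * ?e \<sigma> \<tau>)"
      by (intro sum.cong refl) (simp add: spin_weight_prod_integral(2) del: One_nat_def)
    finally show ?thesis .
  qed
  then have EX: "(\<integral>x. X x \<partial>gaussP sites) \<le> sqrt 2"
    using overlap_exp_moment[OF fix_point] by simp
  have X_ge: "X x \<ge> 1" for x
  proof -
    have "gibbs (?S \<times> ?S) (?H x) (\<lambda>_. 1) \<le> X x"
      unfolding X_def by (intro gibbs_mono S) auto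
    then show ?thesis by (simp add: gibbs_const[OF S])
  qed
  have "coupled_free_energy 0 - 2 * free_energy 0 = (\<integral>x. ln (pf (?S \<times> ?S) (pair_energy 0 x)) - 2 * ln (pf ?S (energy 0 x)) \<partial>gaussP sites)"
  proof -
    have "integrable (gaussP sites) (\<lambda>x. ln (pf ?S (energy 0 x)))"
      unfolding energy_def [abs_def] by (rule integrable_ln_pf[OF S1 finite_sites])
    moreover have "integrable (gaussP sites) (\<lambda>x. ln (pf (?S \<times> ?S) (pair_energy 0 x)))"
      unfolding pair_energy_def [abs_def] by (rule integrable_ln_pf[OF S finite_sites])
    ultimately show ?thesis unfolding free_energy_def coupled_free_energy_def by simp
  qed
  also have "\<dots> = (\<integral>x. ln (X x) \<partial>gaussP sites)"
  proof (intro Bochner_Integration.integral_cong refl)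
    fix x
    have "pf (?S \<times> ?S) (pair_energy 0 x) = (pf ?S (energy 0 x))\<^sup>2 * X x"
      unfolding pair_energy_eq pf_add[OF S] pf_pair X_def by (simp add: coupling_def split_def)
    then show "ln (pf (?S \<times> ?S) (pair_energy 0 x)) - 2 * ln (pf ?S (energy 0 x)) = ln (X x)"
      using pf_pos[OF S1, of "energy 0 x"] X_ge[of x] by (simp add: ln_mult ln_realpow)
  qed
  \<comment> \<open>Jensen via the tangent of ln at sqrt 2. The rule \<open>integral_mono'\<close>
    asks for integrability of the upper function only, hence the nonnegativity goal.\<close>
  also have "\<dots> \<le> (\<integral>x. ln (sqrt 2) - 1 + X x / sqrt 2 \<partial>gaussP sites)"
  proof (rule integral_mono')
    show "integrable (gaussP sites) (\<lambda>x. ln (sqrt 2) - 1 + X x / sqrt 2)" using X_int by simp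
    fix x
    have "ln (X x / sqrt 2) \<le> X x / sqrt 2 - 1" using X_ge[of x] by (intro ln_le_minus_one) auto
    then show le: "ln (X x) \<le> ln (sqrt 2) - 1 + X x / sqrt 2"
      using X_ge[of x] by (simp add: ln_div)
    show "0 \<le> ln (sqrt 2) - 1 + X x / sqrt 2"
      using le X_ge[of x] by (smt (verit) ln_ge_zero)
  qed
  also have "\<dots> = ln (sqrt 2) - 1 + (\<integral>x. X x \<partial>gaussP sites) / sqrt 2"
    using X_int gauss_prod.P.prob_space[of sites] by simp
  also have "\<dots> \<le> ln (sqrt 2)"
    using EX by (simp add: divide_le_eq)
  finally show ?thesis .
qed

end

section \<open>The limiting free energy\<close>

text \<open>Intermediate value theorem between 0 and 1, where tanh^2 takes its values; continuity in
  q is by dominated convergence.\<close>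

lemma field_mean_fixed_point: "\<exists>q\<ge>0. field_mean \<beta> h q = q"
proof -
  have sq: "0 \<le> (tanh x)\<^sup>2" "(tanh x)\<^sup>2 \<le> 1" for x :: real
    using abs_tanh_less_1[of x] by (simp_all add: abs_square_le_1)
  have meas: "(\<lambda>x. (tanh (h + \<beta> * sqrt q * x))\<^sup>2) \<in> borel_measurable gauss" for q by simp
  have "continuous_on {0..1} (\<lambda>q. q - field_mean \<beta> h q)"
  proof (intro continuous_on_diff continuous_on_id continuous_on_sequentiallyI)
    fix u :: "nat \<Rightarrow> real" and a assume u: "u \<longlonglongrightarrow> a"
    show "(\<lambda>n. field_mean \<beta> h (u n)) \<longlonglongrightarrow> field_mean \<beta> h a"
      unfolding field_mean_def
    proof (rule integral_dominated_convergence[where w = "\<lambda>_. 1"])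
      show "AE x in gauss. (\<lambda>n. (tanh (h + \<beta> * sqrt (u n) * x))\<^sup>2) \<longlonglongrightarrow> (tanh (h + \<beta> * sqrt a * x))\<^sup>2"
        by (intro AE_I2 tendsto_intros u) auto
      show "AE x in gauss. norm ((tanh (h + \<beta> * sqrt (u n) * x))\<^sup>2) \<le> 1" for n
        using sq by (intro AE_I2) simp
    qed (auto intro: meas)
  qed
  moreover have "field_mean \<beta> h 0 \<ge> 0"
    unfolding field_mean_def by (intro integral_nonneg_AE AE_I2 sq)
  moreover have "field_mean \<beta> h 1 \<le> (\<integral>x. 1 \<partial>gauss)"
    unfolding field_mean_def
    by (intro integral_mono gauss.integrable_const_bound[where B = 1] AE_I2 meas) (use sq in auto)
  then have "field_mean \<beta> h 1 \<le> 1" by simp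
  ultimately have "\<exists>q\<ge>0. q \<le> 1 \<and> q - field_mean \<beta> h q = 0"
    by (intro IVT') auto
  then show ?thesis by auto
qed

lemma ln_pf_le:
  assumes "finite S" "S \<noteq> {}" "\<And>s. s \<in> S \<Longrightarrow> H s \<le> H' s + d"
  shows "ln (pf S H) \<le> ln (pf S H') + d"
proof -
  have "pf S H \<le> (\<Sum>s\<in>S. exp (H' s) * exp d)"
    unfolding pf_def using assms(3) by (intro sum_mono) (simp add: exp_add[symmetric])
  also have "\<dots> = pf S H' * exp d"
    unfolding pf_def by (simp add: sum_distrib_right)
  finally have "ln (pf S H) \<le> ln (pf S H' * exp d)"
    using pf_pos[OF assms(1,2)] by (intro ln_mono) auto
  then show ?thesis using pf_pos[OF assms(1,2), of H'] by (simp add: ln_mult)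
qed

section \<open>Fluctuations of the log partition function\<close>

definition pairs :: "nat \<Rightarrow> (nat \<times> nat) set" where
  "pairs N = {1..N} \<times> {1..N}"

text \<open>In standard Gaussian variables, hence sqrt (2 N) in place of sqrt 2, and without the
  normalisation 2^-N.\<close>

definition log_pf :: "real \<Rightarrow> real \<Rightarrow> nat \<Rightarrow> (nat \<times> nat \<Rightarrow> real) \<Rightarrow> real" where
  "log_pf \<beta> h N x = ln (pf (sk_configs N) (\<lambda>\<sigma>. h * (\<Sum>i=1..N. \<sigma> i)
     + (\<Sum>k\<in>pairs N. \<beta> / sqrt (2 * real N) * \<sigma> (fst k) * \<sigma> (snd k) * x k)))"

lemma finite_pairs: "finite (pairs N)"
  by (simp add: pairs_def)

lemma log_pf_measurable: "log_pf \<beta> h N \<in> borel_measurable (gaussP (pairs N))"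
  unfolding log_pf_def [abs_def]
  by (intro borel_measurable_ln measurable_pf measurable_linear_energy)

text \<open>Spins have absolute value 1, so a change of one coupling moves every energy by at most
  this amount, and \<open>ln_pf_le\<close> passes the bound to the logarithm.\<close>

lemma log_pf_coord_lipschitz:
  assumes "k \<in> pairs N" "\<beta> \<ge> 0"
  shows "\<bar>log_pf \<beta> h N (x(k := y)) - log_pf \<beta> h N (x(k := z))\<bar> \<le> \<beta> / sqrt (2 * real N) * \<bar>y - z\<bar>"
proof -
  let ?c = "\<lambda>\<sigma> k. \<beta> / sqrt (2 * real N) * \<sigma> (fst k) * \<sigma> (snd k)"
  have "log_pf \<beta> h N (x(k := y)) \<le> log_pf \<beta> h N (x(k := z)) + \<beta> / sqrt (2 * real N) * \<bar>y - z\<bar>" for y z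
    unfolding log_pf_def
  proof (rule ln_pf_le[OF finite_sk_configs sk_configs_nonempty])
    fix \<sigma> assume \<sigma>: "\<sigma> \<in> sk_configs N"
    have split: "(\<Sum>j\<in>pairs N. ?c \<sigma> j * (x(k := w)) j) = (\<Sum>j\<in>pairs N - {k}. ?c \<sigma> j * x j) + ?c \<sigma> k * w" for w
      using assms(1) finite_pairs by (simp add: sum.remove[of "pairs N" k])
    have "\<bar>\<sigma> (fst k)\<bar> = 1" "\<bar>\<sigma> (snd k)\<bar> = 1"
      using assms(1) \<sigma> by (auto simp: pairs_def intro!: sk_configs_abs)
    then have "\<bar>?c \<sigma> k\<bar> = \<beta> / sqrt (2 * real N)" using assms(2) by (simp add: abs_mult)
    then have "?c \<sigma> k * (y - z) \<le> \<beta> / sqrt (2 * real N) * \<bar>y - z\<bar>"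
      by (metis abs_ge_self abs_mult)
    then have "?c \<sigma> k * y \<le> ?c \<sigma> k * z + \<beta> / sqrt (2 * real N) * \<bar>y - z\<bar>"
      by (simp add: right_diff_distrib)
    then show "h * (\<Sum>i=1..N. \<sigma> i) + (\<Sum>j\<in>pairs N. ?c \<sigma> j * (x(k := y)) j)
      \<le> h * (\<Sum>i=1..N. \<sigma> i) + (\<Sum>j\<in>pairs N. ?c \<sigma> j * (x(k := z)) j) + \<beta> / sqrt (2 * real N) * \<bar>y - z\<bar>"
      unfolding split by linarith
  qed
  from this[of y z] this[of z y] show ?thesis by (simp add: abs_le_iff abs_minus_commute)
qed

text \<open>The N^2 coordinates with squared constant beta^2 / (2 N) add up to beta^2 N / 2; the
  choice s = epsilon / beta^2 minimises the exponent s^2 beta^2 N / 2 - s N epsilon.\<close>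

lemma log_pf_tail:
  assumes "N \<ge> 1" "\<beta> > 0" "\<epsilon> > 0"
  shows "measure (gaussP (pairs N)) {x \<in> space (gaussP (pairs N)).
    N * \<epsilon> \<le> \<bar>log_pf \<beta> h N x - (\<integral>x. log_pf \<beta> h N x \<partial>gaussP (pairs N))\<bar>}
    \<le> 2 * exp (- (\<epsilon>\<^sup>2 / (2 * \<beta>\<^sup>2)) * N)"
proof -
  have "(\<epsilon> / \<beta>\<^sup>2)\<^sup>2 * (\<beta> / sqrt (2 * real N))\<^sup>2 * card (pairs N) - \<epsilon> / \<beta>\<^sup>2 * (N * \<epsilon>)
      = - (\<epsilon>\<^sup>2 / (2 * \<beta>\<^sup>2)) * N"
    using assms by (simp add: pairs_def power_divide power2_eq_square field_simps)
  moreover have "0 \<le> \<epsilon> / \<beta>\<^sup>2" using assms by simp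
  ultimately show ?thesis
    using coord_lipschitz_gaussP_tail[OF finite_pairs log_pf_measurable log_pf_coord_lipschitz, of N \<beta> "\<epsilon> / \<beta>\<^sup>2" "N * \<epsilon>" h]
      assms by simp
qed

text \<open>At pi / 2 the field coefficients vanish, and the remaining coordinates form a marginal
  of the product.\<close>

lemma (in sk_interpolation) free_energy_end: "free_energy (pi / 2) = (\<integral>x. log_pf \<beta> h N x \<partial>gaussP (pairs N))"
proof -
  have sub: "pairs N \<subseteq> sites" by (auto simp: pairs_def sites_def)
  have eq: "ln (pf (sk_configs N) (energy (pi / 2) x)) = log_pf \<beta> h N (restrict x (pairs N))" for x
  proof -
    have "(\<Sum>k\<in>pairs N. \<beta> / sqrt (2 * real N) * \<sigma> (fst k) * \<sigma> (snd k) * restrict x (pairs N) k) =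
      (\<Sum>k\<in>sites. coef (pi / 2) \<sigma> k * x k)" for \<sigma>
      by (rule sum.mono_neutral_cong_left[OF finite_sites sub])
         (auto simp: coef_def sites_def pairs_def)
    then show ?thesis unfolding log_pf_def energy_def [abs_def] by simp
  qed
  have d: "distr (gaussP sites) (gaussP (pairs N)) (\<lambda>x. restrict x (pairs N)) = gaussP (pairs N)"
    by (rule gauss_prod.distr_PiM_restrict_finite[OF finite_pairs sub])
  have "(\<integral>x. log_pf \<beta> h N x \<partial>gaussP (pairs N)) =
    (\<integral>x. log_pf \<beta> h N x \<partial>distr (gaussP sites) (gaussP (pairs N)) (\<lambda>x. restrict x (pairs N)))"
    unfolding d ..
  also have "\<dots> = (\<integral>x. log_pf \<beta> h N (restrict x (pairs N)) \<partial>gaussP sites)"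
    by (rule integral_distr[OF measurable_restrict_subset[OF sub] log_pf_measurable])
  finally show ?thesis unfolding free_energy_def eq by simp
qed

section \<open>Transfer to the disorder \<open>g\<close>\<close>

context sk_disorder
begin

definition std_disorder :: "nat \<Rightarrow> 'a \<Rightarrow> nat \<times> nat \<Rightarrow> real" where
  "std_disorder N \<omega> = (\<lambda>k\<in>pairs N. (case k of (i, j) \<Rightarrow> g N i j \<omega>) / sqrt (1 / real N))"

text \<open>Independence makes the joint law a product. The products over \<open>borel\<close> and
  over \<open>gauss\<close> have the same measurable sets, which justifies the change of target at
  the end.\<close>

lemma distr_std_disorder:
  assumes N: "N \<ge> 1"
  shows "std_disorder N \<in> measurable M (gaussP (pairs N))"
    and "distr M (gaussP (pairs N)) (std_disorder N) = gaussP (pairs N)"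
proof -
  define X where "X = (\<lambda>k :: nat \<times> nat. \<lambda>\<omega>. (case k of (i, j) \<Rightarrow> g N i j \<omega>) / sqrt (1 / real N))"
  have std: "distributed M lborel (X k) std_normal_density" if "k \<in> pairs N" for k
  proof -
    obtain i j where k: "k = (i, j)" by force
    then have "distributed M lborel (g N i j) (normal_density 0 (sqrt (1 / real N)))"
      using gaussian[OF N] that by (auto simp: pairs_def)
    then have "distributed M lborel (\<lambda>x. (g N i j x - 0) / sqrt (1 / real N)) std_normal_density"
      using normal_standard_normal_convert[of "sqrt (1 / real N)" "g N i j" 0] N by simp
    then show ?thesis by (simp add: X_def k)
  qed
  have rv: "X k \<in> borel_measurable M" if "k \<in> pairs N" for k
    using distributed_measurable[OF std[OF that]] by simp
  have distr: "distr M borel (X k) = gauss" if "k \<in> pairs N" for k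
  proof -
    have "distr M borel (X k) = distr M lborel (X k)" by (rule distr_cong) auto
    also have "\<dots> = gauss" using distributed_distr_eq_density[OF std[OF that]] .
    finally show ?thesis .
  qed
  have "indep_vars (\<lambda>_. borel) (\<lambda>k. case k of (i, j) \<Rightarrow> g N i j) (pairs N)"
    using indep[OF N] by (simp add: pairs_def)
  then have "indep_vars (\<lambda>_. borel) (\<lambda>k \<omega>. (case k of (i, j) \<Rightarrow> g N i j) \<omega> / sqrt (1 / real N)) (pairs N)"
    by (rule indep_vars_compose2) auto
  then have "indep_vars (\<lambda>_. borel) X (pairs N)"
    unfolding X_def by (rule back_subst[of "\<lambda>X. indep_vars (\<lambda>_. borel) X (pairs N)"]) (auto simp: fun_eq_iff)
  moreover have "pairs N \<noteq> {}" using N by (simp add: pairs_def)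
  ultimately have "distr M (Pi\<^sub>M (pairs N) (\<lambda>_. borel)) (\<lambda>\<omega>. \<lambda>k\<in>pairs N. X k \<omega>) =
      Pi\<^sub>M (pairs N) (\<lambda>k. distr M borel (X k))"
    using indep_vars_iff_distr_eq_PiM'[of "pairs N" X "\<lambda>_. borel"] rv by simp
  also have "\<dots> = gaussP (pairs N)" by (intro PiM_cong refl distr)
  also have "(\<lambda>\<omega>. \<lambda>k\<in>pairs N. X k \<omega>) = std_disorder N"
    by (auto simp: std_disorder_def X_def fun_eq_iff)
  finally have d: "distr M (Pi\<^sub>M (pairs N) (\<lambda>_. borel)) (std_disorder N) = gaussP (pairs N)" .
  have sets: "sets (Pi\<^sub>M (pairs N) (\<lambda>_. borel :: real measure)) = sets (gaussP (pairs N))"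
    by (intro sets_PiM_cong) auto
  have "std_disorder N \<in> measurable M (Pi\<^sub>M (pairs N) (\<lambda>_. borel))"
    unfolding std_disorder_def using rv by (intro measurable_restrict) (simp add: X_def)
  then show "std_disorder N \<in> measurable M (gaussP (pairs N))"
    using measurable_cong_sets[OF refl sets] by blast
  show "distr M (gaussP (pairs N)) (std_disorder N) = gaussP (pairs N)"
    using d distr_cong[OF refl sets, of M "std_disorder N" "std_disorder N"] by simp
qed

lemma sk_log_density_eq:
  assumes N: "N \<ge> 1"
  shows "sk_log_density g \<beta> h N \<omega> = (log_pf \<beta> h N (std_disorder N \<omega>) - N * ln 2) / N"
proof -
  have s: "\<beta> / sqrt 2 * y = \<beta> / sqrt (2 * real N) * (y / sqrt (1 / real N))" for y
    using N by (simp add: real_sqrt_mult real_sqrt_divide)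
  have "sk_energy \<beta> h N (\<lambda>i j. g N i j \<omega>) \<sigma> = h * (\<Sum>i=1..N. \<sigma> i)
     + (\<Sum>k\<in>pairs N. \<beta> / sqrt (2 * real N) * \<sigma> (fst k) * \<sigma> (snd k) * std_disorder N \<omega> k)" for \<sigma>
  proof -
    have "\<beta> / sqrt 2 * (\<Sum>i=1..N. \<Sum>j=1..N. g N i j \<omega> * \<sigma> i * \<sigma> j) =
        (\<Sum>i=1..N. \<Sum>j=1..N. \<beta> / sqrt 2 * g N i j \<omega> * (\<sigma> i * \<sigma> j))"
      by (simp only: sum_distrib_left mult.assoc)
    also have "\<dots> = (\<Sum>k\<in>pairs N. \<beta> / sqrt (2 * real N) * \<sigma> (fst k) * \<sigma> (snd k) * std_disorder N \<omega> k)"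
      unfolding sum.cartesian_product pairs_def[symmetric]
    proof (intro sum.cong refl, clarify)
      fix i j assume "(i, j) \<in> pairs N"
      then show "\<beta> / sqrt 2 * g N i j \<omega> * (\<sigma> i * \<sigma> j) =
        \<beta> / sqrt (2 * real N) * \<sigma> (fst (i, j)) * \<sigma> (snd (i, j)) * std_disorder N \<omega> (i, j)"
        unfolding s by (simp add: std_disorder_def)
    qed
    finally show ?thesis unfolding sk_energy_def by simp
  qed
  then have Z: "sk_partition \<beta> h N (\<lambda>i j. g N i j \<omega>) = pf (sk_configs N) (\<lambda>\<sigma>. h * (\<Sum>i=1..N. \<sigma> i)
     + (\<Sum>k\<in>pairs N. \<beta> / sqrt (2 * real N) * \<sigma> (fst k) * \<sigma> (snd k) * std_disorder N \<omega> k)) / 2 ^ N"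
    unfolding sk_partition_def pf_def by simp
  have "ln (pf (sk_configs N) H / 2 ^ N) = ln (pf (sk_configs N) H) - N * ln 2" for H
    using pf_pos[OF finite_sk_configs sk_configs_nonempty, of N H] by (simp add: ln_div ln_realpow)
  then show ?thesis
    unfolding sk_log_density_def log_pf_def Z by simp
qed

lemma sk_log_density_measurable: "sk_log_density g \<beta> h N \<in> borel_measurable M"
proof (cases "N \<ge> 1")
  case True
  have "(\<lambda>\<omega>. log_pf \<beta> h N (std_disorder N \<omega>)) \<in> borel_measurable M"
    by (rule measurable_compose[OF distr_std_disorder(1)[OF True] log_pf_measurable])
  then show ?thesis unfolding sk_log_density_eq[OF True, abs_def] by simp
next
  case False
  then have "N = 0" by simp
  \<comment> \<open>Division by \<open>real 0\<close> yields the constant 0.\<close>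
  then show ?thesis by (simp add: sk_log_density_def [abs_def])
qed

lemma log_pf_integrable: "integrable (gaussP (pairs N)) (log_pf \<beta> h N)"
  unfolding log_pf_def [abs_def]
  by (rule integrable_ln_pf[OF finite_sk_configs sk_configs_nonempty finite_pairs])

lemma expectation_sk_log_density:
  assumes N: "N \<ge> 1"
  shows "(\<integral>\<omega>. sk_log_density g \<beta> h N \<omega> \<partial>M) = ((\<integral>x. log_pf \<beta> h N x \<partial>gaussP (pairs N)) - N * ln 2) / N"
proof -
  note d = distr_std_disorder[OF N]
  have "(\<integral>x. log_pf \<beta> h N x \<partial>gaussP (pairs N)) = (\<integral>\<omega>. log_pf \<beta> h N (std_disorder N \<omega>) \<partial>M)"
    using integral_distr[OF d(1) log_pf_measurable, of \<beta> h] unfolding d(2) .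
  moreover have "integrable M (\<lambda>\<omega>. log_pf \<beta> h N (std_disorder N \<omega>))"
    using integrable_distr_eq[OF d(1) log_pf_measurable, of \<beta> h] log_pf_integrable unfolding d(2) by simp
  ultimately show ?thesis
    unfolding sk_log_density_eq[OF N] by (simp add: prob_space)
qed

lemma sk_log_density_tail:
  assumes N: "N \<ge> 1" and beta: "\<beta> > 0" and eps: "\<epsilon> > 0"
  shows "prob {\<omega> \<in> space M. \<epsilon> \<le> \<bar>sk_log_density g \<beta> h N \<omega> - (\<integral>\<omega>. sk_log_density g \<beta> h N \<omega> \<partial>M)\<bar>}
    \<le> 2 * exp (- (\<epsilon>\<^sup>2 / (2 * \<beta>\<^sup>2)) * N)"
proof -
  note d = distr_std_disorder[OF N]
  define m where "m = (\<integral>x. log_pf \<beta> h N x \<partial>gaussP (pairs N))"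
  define B where "B = {x \<in> space (gaussP (pairs N)). N * \<epsilon> \<le> \<bar>log_pf \<beta> h N x - m\<bar>}"
  have B: "B \<in> sets (gaussP (pairs N))"
    unfolding B_def using log_pf_measurable[of \<beta> h N] by measurable
  have dev: "\<bar>sk_log_density g \<beta> h N \<omega> - (\<integral>\<omega>. sk_log_density g \<beta> h N \<omega> \<partial>M)\<bar> =
      \<bar>log_pf \<beta> h N (std_disorder N \<omega>) - m\<bar> / N" for \<omega>
  proof -
    have "sk_log_density g \<beta> h N \<omega> - (\<integral>\<omega>. sk_log_density g \<beta> h N \<omega> \<partial>M) =
      (log_pf \<beta> h N (std_disorder N \<omega>) - m) / N"
      unfolding expectation_sk_log_density[OF N]
      unfolding sk_log_density_eq[OF N] m_def diff_divide_distrib by simp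
    then show ?thesis by simp
  qed
  have "{\<omega> \<in> space M. \<epsilon> \<le> \<bar>sk_log_density g \<beta> h N \<omega> - (\<integral>\<omega>. sk_log_density g \<beta> h N \<omega> \<partial>M)\<bar>} =
      std_disorder N -` B \<inter> space M"
    unfolding dev B_def using measurable_space[OF d(1)] N by (auto simp: field_simps)
  then have "prob {\<omega> \<in> space M. \<epsilon> \<le> \<bar>sk_log_density g \<beta> h N \<omega> - (\<integral>\<omega>. sk_log_density g \<beta> h N \<omega> \<partial>M)\<bar>} =
      measure (gaussP (pairs N)) B"
    using measure_distr[OF d(1) B] unfolding d(2) by simp
  also have "\<dots> \<le> 2 * exp (- (\<epsilon>\<^sup>2 / (2 * \<beta>\<^sup>2)) * N)"
    unfolding B_def m_def by (rule log_pf_tail[OF N beta eps])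
  finally show ?thesis .
qed

text \<open>The ln 2 per site in \<open>free_energy_0\<close> cancels the normalisation 2^-N. The
  error of the lower bound is the bounded deficit divided by N.\<close>

lemma expectation_bounds:
  fixes \<beta> h q :: real
  assumes N: "N \<ge> 1" and beta: "0 < \<beta>" "\<beta> \<le> 1 / 2" and q: "q \<ge> 0"
  defines "val \<equiv> (\<integral>x. ln (cosh (h + \<beta> * sqrt q * x)) \<partial>gauss) + \<beta>\<^sup>2 * (1 - q)\<^sup>2 / 4"
  shows "(\<integral>\<omega>. sk_log_density g \<beta> h N \<omega> \<partial>M) \<le> val"
    and "field_mean \<beta> h q = q \<Longrightarrow> val - ln (sqrt 2) * exp pi / N \<le> (\<integral>\<omega>. sk_log_density g \<beta> h N \<omega> \<partial>M)"
proof -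
  interpret sk_interpolation N \<beta> h q
    using assms by unfold_locales auto
  have E: "(\<integral>\<omega>. sk_log_density g \<beta> h N \<omega> \<partial>M) = (free_energy (pi / 2) - N * ln 2) / N"
    unfolding expectation_sk_log_density[OF N] free_energy_end ..
  have V: "N * val = free_energy 0 - N * ln 2 + N * (\<beta>\<^sup>2 / 4 * (1 - q)\<^sup>2)"
    unfolding free_energy_0 val_def by (simp add: algebra_simps)
  show "(\<integral>\<omega>. sk_log_density g \<beta> h N \<omega> \<partial>M) \<le> val"
    unfolding E using guerra_upper V N by (simp add: divide_le_eq mult.commute)
  assume "field_mean \<beta> h q = q"
  then have "N * val - ln (sqrt 2) * exp pi \<le> free_energy (pi / 2) - N * ln 2"
    using guerra_lower[OF coupled_free_energy_0_le] V by linarith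
  then have "(N * val - ln (sqrt 2) * exp pi) / N \<le> (free_energy (pi / 2) - N * ln 2) / N"
    by (rule divide_right_mono) simp
  then show "val - ln (sqrt 2) * exp pi / N \<le> (\<integral>\<omega>. sk_log_density g \<beta> h N \<omega> \<partial>M)"
    unfolding E using N by (simp add: diff_divide_distrib)
qed

text \<open>The upper bound, valid for all q, passes to the infimum; for the lower bound it suffices
  that the infimum is at most the value at the fixed point.\<close>

lemma expectation_tendsto_RS:
  assumes beta: "0 < \<beta>" "\<beta> \<le> 1 / 2"
  shows "(\<lambda>N. \<integral>\<omega>. sk_log_density g \<beta> h N \<omega> \<partial>M) \<longlonglongrightarrow> RS \<beta> h"
proof -
  let ?v = "\<lambda>q. (\<integral>x. ln (cosh (h + \<beta> * sqrt q * x)) \<partial>gauss) + \<beta>\<^sup>2 * (1 - q)\<^sup>2 / 4"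
  have v0: "0 \<le> ?v q" for q
    by (intro add_nonneg_nonneg integral_nonneg_AE AE_I2 ln_cosh_bounds) auto
  obtain q where q: "q \<ge> 0" "field_mean \<beta> h q = q" using field_mean_fixed_point by blast
  have "RS \<beta> h \<le> ?v q"
    unfolding RS_def using q by (intro cINF_lower bdd_belowI2[where m = 0] v0) auto
  then have lower: "RS \<beta> h - ln (sqrt 2) * exp pi / N \<le> (\<integral>\<omega>. sk_log_density g \<beta> h N \<omega> \<partial>M)" if "N \<ge> 1" for N
    using expectation_bounds(2)[OF that beta q] by linarith
  have upper: "(\<integral>\<omega>. sk_log_density g \<beta> h N \<omega> \<partial>M) \<le> RS \<beta> h" if "N \<ge> 1" for N
    unfolding RS_def using expectation_bounds(1)[OF that beta] by (intro cINF_greatest) auto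
  show ?thesis
  proof (rule tendsto_sandwich)
    show "\<forall>\<^sub>F N in sequentially. RS \<beta> h - ln (sqrt 2) * exp pi / N \<le> (\<integral>\<omega>. sk_log_density g \<beta> h N \<omega> \<partial>M)"
      by (rule eventually_sequentiallyI[of 1]) (rule lower)
    show "\<forall>\<^sub>F N in sequentially. (\<integral>\<omega>. sk_log_density g \<beta> h N \<omega> \<partial>M) \<le> RS \<beta> h"
      by (rule eventually_sequentiallyI[of 1]) (rule upper)
    show "(\<lambda>N. RS \<beta> h - ln (sqrt 2) * exp pi / real N) \<longlonglongrightarrow> RS \<beta> h"
      using tendsto_diff[OF tendsto_const lim_const_over_n] by fastforce
  qed (rule tendsto_const)
qed

end

theorem theorem1:
  shows "\<exists>\<beta>0>0. \<forall>(M :: 'a measure) g. sk_disorder M g \<longrightarrow>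
    (\<forall>h \<beta>. 0 < \<beta> \<and> \<beta> \<le> \<beta>0 \<longrightarrow>
      (AE \<omega> in M. (\<lambda>N. sk_log_density g \<beta> h N \<omega>) \<longlonglongrightarrow> sk_free_energy M g \<beta> h) \<and>
      (\<lambda>N. \<integral>\<omega>. sk_log_density g \<beta> h N \<omega> \<partial>M) \<longlonglongrightarrow> sk_free_energy M g \<beta> h \<and>
      sk_free_energy M g \<beta> h = RS \<beta> h)"
proof (intro exI[of _ "1 / 2"] conjI allI impI)
  \<comment> \<open>The witness is the bound on beta in \<open>sk_interpolation\<close>.\<close>
  show "(0 :: real) < 1 / 2" by simp
  fix M :: "'a measure" and g and h \<beta> :: real
  assume "sk_disorder M g" and "0 < \<beta> \<and> \<beta> \<le> 1 / 2"
  then interpret sk_disorder M g by simp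
  have beta: "0 < \<beta>" "\<beta> \<le> 1 / 2" using \<open>0 < \<beta> \<and> \<beta> \<le> 1 / 2\<close> by auto
  have lim: "(\<lambda>N. \<integral>\<omega>. sk_log_density g \<beta> h N \<omega> \<partial>M) \<longlonglongrightarrow> RS \<beta> h"
    by (rule expectation_tendsto_RS[OF beta])
  then show eq: "sk_free_energy M g \<beta> h = RS \<beta> h"
    unfolding sk_free_energy_def by (rule limI)
  show "(\<lambda>N. \<integral>\<omega>. sk_log_density g \<beta> h N \<omega> \<partial>M) \<longlonglongrightarrow> sk_free_energy M g \<beta> h"
    unfolding eq by (rule lim)
  show "AE \<omega> in M. (\<lambda>N. sk_log_density g \<beta> h N \<omega>) \<longlonglongrightarrow> sk_free_energy M g \<beta> h"
    unfolding eq
  proof (rule AE_tendsto_of_exp_tail[where c = "\<lambda>\<epsilon>. \<epsilon>\<^sup>2 / (2 * \<beta>\<^sup>2)", OF _ _ _ lim])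
    show "prob {\<omega> \<in> space M. \<epsilon> \<le> \<bar>sk_log_density g \<beta> h n \<omega> - (\<integral>\<omega>. sk_log_density g \<beta> h n \<omega> \<partial>M)\<bar>}
        \<le> 2 * exp (- (\<epsilon>\<^sup>2 / (2 * \<beta>\<^sup>2)) * n)" if "n \<ge> 1" "\<epsilon> > 0" for n \<epsilon>
      using sk_log_density_tail[OF that(1) beta(1) that(2)] .
  qed (use beta sk_log_density_measurable in auto)
qed

end
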